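(* Let $\mathbb{K}$ be a field of characteristic zero. Let $H$ be a graph on $n$ vertices with independence number $\alpha(H)\ge n/3+2$, and let $G=w(H)$ be its whiskering. Then the form $F(G)$ is the Macaulay dual generator of a G-quadratic artinian Gorenstein algebra that fails the weak Lefschetz property.
   Context: Whiskering: for a graph $H$ on vertex set $\{1,\dots,n\}$, $w(H)$ is the graph on $\{1,\dots,2n\}$ whose edges are the edges of $H$ together with $\{i,i+n\}$ for $1\le i\le n$. The independence number $\alpha(H)$ is the largest size of an independent set of $H$. If $F_1,\dots,F_m$ are the maximal independent sets of $G$ (all of the same size when $G$ is whiskered), then $$F(G)=\sum_{i=1}^m x_iu_{F_i}\in\mathbb{K}[x_1,\dots,x_m,u_1,\dots,u_{2n}],\qquad u_{F_i}=\prod_{j\in F_i}u_j.$$ Macaulay duality: for a polynomial ring $R=\mathbb{K}[z_1,\dots,z_N]$ acting on $S=\mathbb{K}[Z_1,\dots,Z_N]$ by $z_i=\partial/\partial Z_i$ and a homogeneous $F\in S$, put $\mathrm{Ann}(F)=\{g\in R: g\circ F=0\}$. Then $A_F=R/\mathrm{Ann}(F)$ is a standard graded artinian Gorenstein algebra, and $F$ is called its Macaulay dual generator. (The rings $R$ and $S$ are identified when no confusion arises.) An algebra $R/I$ is G-quadratic if the ideal $I$ has a quadratic Gröbner basis. A graded artinian algebra $A$ has the weak Lefschetz property if there is $L\in A_1$ such that every multiplication map $\times L:A_i\to A_{i+1}$ is injective or surjective. *)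

theory Defs
  imports Complex_Main "HOL-Library.Poly_Mapping" "HOL-Algebra.QuotRing"
begin

section \<open>Simple graphs, independent sets, whiskering\<close>

definition simple_graph :: "'a set \<Rightarrow> 'a set set \<Rightarrow> bool" where
  "simple_graph V E \<longleftrightarrow> finite V \<and> (\<forall>e\<in>E. e \<subseteq> V \<and> card e = 2)"

definition independent_sets :: "'a set \<Rightarrow> 'a set set \<Rightarrow> 'a set set" where
  "independent_sets V E = {S. S \<subseteq> V \<and> (\<forall>e\<in>E. \<not> e \<subseteq> S)}"

definition independence_number :: "'a set \<Rightarrow> 'a set set \<Rightarrow> nat" where
  "independence_number V E = Max (card ` independent_sets V E)"

definition maximal_independent_sets :: "'a set \<Rightarrow> 'a set set \<Rightarrow> 'a set set" where
  "maximal_independent_sets V E =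
     {S \<in> independent_sets V E. \<forall>T\<in>independent_sets V E. S \<subseteq> T \<longrightarrow> T = S}"

text \<open>Edge set of the whiskering of a graph on \<open>{1..n}\<close>; its vertex set is \<open>{1..2 * n}\<close>.\<close>

definition whisker :: "nat \<Rightarrow> nat set set \<Rightarrow> nat set set" where
  "whisker n E = E \<union> {{i, i + n} | i. i \<in> {1..n}}"


section \<open>Polynomial rings in a finite set of variables\<close>

text \<open>
  A polynomial maps monomials (finitely supported exponent vectors) to coefficients.
  The ring \<open>K[V]\<close> consists of the polynomials all of whose monomials only involve
  variables from \<open>V\<close>.
\<close>

type_synonym 'v monom = "'v \<Rightarrow>\<^sub>0 nat"
type_synonym ('v, 'k) mpoly = "('v \<Rightarrow>\<^sub>0 nat) \<Rightarrow>\<^sub>0 'k"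

definition monoms :: "'v set \<Rightarrow> 'v monom set" where
  "monoms V = {t. Poly_Mapping.keys t \<subseteq> V}"

definition mdeg :: "'v monom \<Rightarrow> nat" where
  "mdeg t = (\<Sum>v\<in>Poly_Mapping.keys t. Poly_Mapping.lookup t v)"

definition Var :: "'v \<Rightarrow> ('v, 'k::comm_ring_1) mpoly" where
  "Var v = Poly_Mapping.single (Poly_Mapping.single v 1) 1"

definition Const :: "'k \<Rightarrow> ('v, 'k::comm_ring_1) mpoly" where
  "Const c = Poly_Mapping.single 0 c"

definition poly_ring :: "'v set \<Rightarrow> ('v, 'k::comm_ring_1) mpoly ring" where
  "poly_ring V = \<lparr>carrier = {p. Poly_Mapping.keys p \<subseteq> monoms V},
     mult = (*), one = 1, zero = 0, add = (+)\<rparr>"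

text \<open>Forms of degree \<open>d\<close> in \<open>K[V]\<close>, the zero polynomial included.\<close>

definition forms :: "'v set \<Rightarrow> nat \<Rightarrow> ('v, 'k::comm_ring_1) mpoly set" where
  "forms V d = {p \<in> carrier (poly_ring V). \<forall>t\<in>Poly_Mapping.keys p. mdeg t = d}"

definition hom_component :: "nat \<Rightarrow> ('v, 'k::comm_ring_1) mpoly \<Rightarrow> ('v, 'k) mpoly" where
  "hom_component d p = (\<Sum>t\<in>{t \<in> Poly_Mapping.keys p. mdeg t = d}.
     Poly_Mapping.single t (Poly_Mapping.lookup p t))"

definition homogeneous_ideal :: "'v set \<Rightarrow> ('v, 'k::comm_ring_1) mpoly set \<Rightarrow> bool" where
  "homogeneous_ideal V I \<longleftrightarrow>
     ideal I (poly_ring V) \<and> (\<forall>p\<in>I. \<forall>d. hom_component d p \<in> I)"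

lemma monoms_add: "s \<in> monoms V \<Longrightarrow> t \<in> monoms V \<Longrightarrow> s + t \<in> monoms V"
  unfolding monoms_def using Poly_Mapping.keys_add[of s t] by blast

lemma cring_poly_ring: "cring (poly_ring V :: ('v, 'k::comm_ring_1) mpoly ring)"
proof -
  let ?R = "poly_ring V :: ('v, 'k) mpoly ring"
  have zero: "0 \<in> carrier ?R" and one: "1 \<in> carrier ?R"
    by (auto simp: poly_ring_def monoms_def)
  have add: "p + q \<in> carrier ?R" if "p \<in> carrier ?R" "q \<in> carrier ?R" for p q
    using that Poly_Mapping.keys_add[of p q] by (auto simp: poly_ring_def)
  have mult: "p * q \<in> carrier ?R" if "p \<in> carrier ?R" "q \<in> carrier ?R" for p q
    using that keys_mult[of p q] by (fastforce simp: poly_ring_def dest: subsetD intro: monoms_add)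
  have uminus: "- p \<in> carrier ?R" if "p \<in> carrier ?R" for p
    using that by (auto simp: poly_ring_def)
  show ?thesis
  proof (rule cringI)
    show "abelian_group ?R"
    proof (rule abelian_groupI)
      fix p assume p: "p \<in> carrier ?R"
      show "\<exists>q\<in>carrier ?R. q \<oplus>\<^bsub>?R\<^esub> p = \<zero>\<^bsub>?R\<^esub>"
        using uminus[OF p] by (intro bexI[of _ "- p"]) (auto simp: poly_ring_def)
    qed (use zero add in \<open>auto simp: poly_ring_def add_ac\<close>)
    show "comm_monoid ?R"
      by (rule comm_monoidI) (use one mult in \<open>auto simp: poly_ring_def mult_ac\<close>)
  qed (auto simp: poly_ring_def algebra_simps)
qed


section \<open>Macaulay duality\<close>

definition partial_deriv :: "'v \<Rightarrow> ('v, 'k::comm_ring_1) mpoly \<Rightarrow> ('v, 'k) mpoly" where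
  "partial_deriv v p = (\<Sum>t\<in>Poly_Mapping.keys p.
     Poly_Mapping.single (t - Poly_Mapping.single v 1)
       (of_nat (Poly_Mapping.lookup t v) * Poly_Mapping.lookup p t))"

text \<open>
  The monomial \<open>s\<close> acts by applying, for each of its variables \<open>v\<close>, the derivation
  \<open>partial_deriv v\<close> exactly \<open>lookup s v\<close> times. The fold is independent of the order of the
  variables because partial derivatives commute, see \<open>monom_act_commute\<close> below.
\<close>

definition monom_act :: "'v monom \<Rightarrow> ('v, 'k::comm_ring_1) mpoly \<Rightarrow> ('v, 'k) mpoly" where
  "monom_act s p = Finite_Set.fold
     (\<lambda>v. partial_deriv v ^^ Poly_Mapping.lookup s v) p (Poly_Mapping.keys s)"

definition poly_act :: "('v, 'k::comm_ring_1) mpoly \<Rightarrow> ('v, 'k) mpoly \<Rightarrow> ('v, 'k) mpoly" where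
  "poly_act g p =
     (\<Sum>s\<in>Poly_Mapping.keys g. Const (Poly_Mapping.lookup g s) * monom_act s p)"

definition Ann :: "'v set \<Rightarrow> ('v, 'k::comm_ring_1) mpoly \<Rightarrow> ('v, 'k) mpoly set" where
  "Ann V F = {g \<in> carrier (poly_ring V). poly_act g F = 0}"

definition macaulay_dual_generator ::
    "'v set \<Rightarrow> ('v, 'k::comm_ring_1) mpoly \<Rightarrow> ('v, 'k) mpoly set \<Rightarrow> bool" where
  "macaulay_dual_generator V F I \<longleftrightarrow> F \<noteq> 0 \<and> (\<exists>d. F \<in> forms V d) \<and> I = Ann V F"

lemma lookup_partial_deriv:
  "Poly_Mapping.lookup (partial_deriv v p) t =
     of_nat (Poly_Mapping.lookup t v + 1) * Poly_Mapping.lookup p (t + Poly_Mapping.single v 1)"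
proof -
  let ?e = "Poly_Mapping.single v (1::nat)"
  have eq: "Poly_Mapping.lookup (Poly_Mapping.single (s - ?e)
        (of_nat (Poly_Mapping.lookup s v) * Poly_Mapping.lookup p s)) t =
      (if s = t + ?e
       then of_nat (Poly_Mapping.lookup t v + 1) * Poly_Mapping.lookup p (t + ?e) else 0)" for s
  proof (cases "Poly_Mapping.lookup s v = 0")
    case True
    moreover have "s \<noteq> t + ?e"
      using True by (auto simp: lookup_add)
    ultimately show ?thesis by simp
  next
    case False
    then have "s - ?e + ?e = s"
      by (intro poly_mapping_eqI) (auto simp: lookup_add lookup_minus lookup_single when_def)
    then have "s - ?e = t \<longleftrightarrow> s = t + ?e"
      by (metis add_diff_cancel_right')
    then show ?thesis
      by (auto simp: lookup_single when_def lookup_add)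
  qed
  show ?thesis
    unfolding partial_deriv_def
    by (simp only: lookup_sum eq) (auto simp: in_keys_iff)
qed

lemma partial_deriv_commute:
  "partial_deriv v (partial_deriv w p) = partial_deriv w (partial_deriv v p)"
  by (rule poly_mapping_eqI, cases "v = w")
     (simp_all add: lookup_partial_deriv lookup_add lookup_single when_def add_ac mult_ac)

lemma monom_act_commute:
  fixes s :: "'v monom"
  shows "comp_fun_commute (\<lambda>v. (partial_deriv v ::
     ('v, 'k::comm_ring_1) mpoly \<Rightarrow> _) ^^ Poly_Mapping.lookup s v)"
proof -
  have 1: "partial_deriv v ((partial_deriv w ^^ b) p) = (partial_deriv w ^^ b) (partial_deriv v p)"
    for v w :: 'v and b and p :: "('v, 'k) mpoly"
    by (induction b) (simp_all add: partial_deriv_commute[of v w])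
  have 2: "(partial_deriv v ^^ a) ((partial_deriv w ^^ b) p) =
      (partial_deriv w ^^ b) ((partial_deriv v ^^ a) p)"
    for v w :: 'v and a b and p :: "('v, 'k) mpoly"
    by (induction a) (simp_all add: 1)
  show ?thesis
    by standard (auto simp: fun_eq_iff 2)
qed

lemma poly_act_Var: "poly_act (Var v) p = partial_deriv v p"
proof -
  interpret comp_fun_commute "\<lambda>w. (partial_deriv w ::
     ('a, 'b) mpoly \<Rightarrow> _) ^^ Poly_Mapping.lookup (Poly_Mapping.single v (1::nat)) w"
    by (rule monom_act_commute)
  show ?thesis
    by (simp add: poly_act_def Var_def monom_act_def Const_def)
qed


section \<open>Graded quotients of polynomial rings\<close>

definition quot_class :: "'v set \<Rightarrow> ('v, 'k::comm_ring_1) mpoly set \<Rightarrow>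
    ('v, 'k) mpoly \<Rightarrow> ('v, 'k) mpoly set" where
  "quot_class V I p = I +>\<^bsub>poly_ring V\<^esub> p"

definition graded_piece :: "'v set \<Rightarrow> ('v, 'k::comm_ring_1) mpoly set \<Rightarrow> nat \<Rightarrow>
    ('v, 'k) mpoly set set" where
  "graded_piece V I d = quot_class V I ` forms V d"

definition artinian_ring :: "('a, 'b) ring_scheme \<Rightarrow> bool" where
  "artinian_ring R \<longleftrightarrow> ring R \<and>
     (\<forall>J :: nat \<Rightarrow> 'a set. (\<forall>i. ideal (J i) R \<and> J (Suc i) \<subseteq> J i) \<longrightarrow>
        (\<exists>k. \<forall>i\<ge>k. J i = J k))"

text \<open>The annihilator of the irrelevant maximal ideal of \<open>K[V]/I\<close>.\<close>

definition socle :: "'v set \<Rightarrow> ('v, 'k::comm_ring_1) mpoly set \<Rightarrow> ('v, 'k) mpoly set set" where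
  "socle V I = {a \<in> carrier (poly_ring V Quot I).
     \<forall>d\<ge>1. \<forall>b\<in>graded_piece V I d. b \<otimes>\<^bsub>poly_ring V Quot I\<^esub> a = \<zero>\<^bsub>poly_ring V Quot I\<^esub>}"

text \<open>
  A standard graded artinian algebra \<open>K[V]/I\<close> is Gorenstein if its socle is
  a one-dimensional \<open>K\<close>-vector space.
\<close>

definition artinian_gorenstein :: "'v set \<Rightarrow> ('v, 'k::field) mpoly set \<Rightarrow> bool" where
  "artinian_gorenstein V I \<longleftrightarrow>
     finite V \<and> homogeneous_ideal V I \<and> artinian_ring (poly_ring V Quot I) \<and>
     (\<exists>s\<in>socle V I. s \<noteq> \<zero>\<^bsub>poly_ring V Quot I\<^esub> \<and>
        socle V I = {quot_class V I (Const c) \<otimes>\<^bsub>poly_ring V Quot I\<^esub> s | c. True})"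

definition weak_lefschetz :: "'v set \<Rightarrow> ('v, 'k::field) mpoly set \<Rightarrow> bool" where
  "weak_lefschetz V I \<longleftrightarrow>
     (\<exists>L\<in>graded_piece V I 1. \<forall>i.
        inj_on (\<lambda>a. L \<otimes>\<^bsub>poly_ring V Quot I\<^esub> a) (graded_piece V I i) \<or>
        (\<lambda>a. L \<otimes>\<^bsub>poly_ring V Quot I\<^esub> a) ` graded_piece V I i = graded_piece V I (Suc i))"


section \<open>Quadratic Groebner bases\<close>

text \<open>In a monomial order \<open>r\<close>, the membership \<open>(s, t) \<in> r\<close> means that \<open>s\<close> is at most \<open>t\<close>.\<close>

definition monomial_order :: "'v set \<Rightarrow> 'v monom rel \<Rightarrow> bool" where
  "monomial_order V r \<longleftrightarrow> linear_order_on (monoms V) r \<and>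
     (\<forall>t\<in>monoms V. (0, t) \<in> r) \<and>
     (\<forall>s t u. (s, t) \<in> r \<longrightarrow> u \<in> monoms V \<longrightarrow> (s + u, t + u) \<in> r)"

definition leading_monom :: "'v monom rel \<Rightarrow> ('v, 'k::comm_ring_1) mpoly \<Rightarrow> 'v monom" where
  "leading_monom r p =
     (THE t. t \<in> Poly_Mapping.keys p \<and> (\<forall>s\<in>Poly_Mapping.keys p. (s, t) \<in> r))"

definition initial_ideal :: "'v set \<Rightarrow> 'v monom rel \<Rightarrow> ('v, 'k::comm_ring_1) mpoly set \<Rightarrow>
    ('v, 'k) mpoly set" where
  "initial_ideal V r P =
     Idl\<^bsub>poly_ring V\<^esub> {Poly_Mapping.single (leading_monom r p) 1 | p. p \<in> P \<and> p \<noteq> 0}"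

definition groebner_basis :: "'v set \<Rightarrow> 'v monom rel \<Rightarrow> ('v, 'k::field) mpoly set \<Rightarrow>
    ('v, 'k) mpoly set \<Rightarrow> bool" where
  "groebner_basis V r I G \<longleftrightarrow>
     finite G \<and> G \<subseteq> I \<and> 0 \<notin> G \<and> initial_ideal V r G = initial_ideal V r I"

definition G_quadratic :: "'v set \<Rightarrow> ('v, 'k::field) mpoly set \<Rightarrow> bool" where
  "G_quadratic V I \<longleftrightarrow>
     (\<exists>r G. monomial_order V r \<and> groebner_basis V r I G \<and> G \<subseteq> forms V 2)"


section \<open>The form attached to a graph\<close>

datatype graph_var = X nat | U nat

definition graph_vars :: "nat \<Rightarrow> nat \<Rightarrow> graph_var set" where
  "graph_vars m N = X ` {1..m} \<union> U ` {1..N}"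

definition graph_form :: "nat \<Rightarrow> (nat \<Rightarrow> nat set) \<Rightarrow> (graph_var, 'k::comm_ring_1) mpoly" where
  "graph_form m Fs = (\<Sum>i=1..m. Var (X i) * (\<Prod>j\<in>Fs i. Var (U j)))"

end

(*
  Write \<open>\<phi>(g) = \<Sum> t! F_t g_t\<close> for the linear functional attached to a form F. In characteristic
  zero, g annihilates F iff \<open>\<phi>(g h) = 0\<close> for all h; this gives Macaulay's theorem, the socle being
  spanned by any monomial of F. For \<open>F = \<Sum> x_i u_{F_i}\<close> one has \<open>\<phi>(g) = \<Sum> coeff g (x_i u_{F_i})\<close>.

  The facets of a whiskered graph are \<open>F_S = S \<union> {a + n | a \<notin> S}\<close> for S independent in H. In the
  lexicographic order with \<open>u_1 > u_2 > \<dots>\<close>, a monomial that is divisible by no leading monomial of a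
  quadric in Ann F is either \<open>u_T\<close> with T a face or \<open>x_S u_T\<close> with T a subset of \<open>F_S\<close> disjoint from
  the vertices of H. It cannot be the leading monomial of an element p of Ann F: multiply p with the
  complementary monomial and apply \<open>\<phi>\<close>; all other terms that could contribute are lex-larger.

  Let L be a linear form, \<open>L = \<Sum> c_v v\<close>. Take disjoint pairs of vertices all of whose transversals
  are faces: the pairs \<open>{a, a + n}\<close> for three pairwise nonadjacent vertices a of H, and pairs
  \<open>{i + n, j + n}\<close> of other whisker vertices. For each pair choose a combination of its two variables
  killed by the derivation \<open>D = \<Sum> c_v \<partial>/\<partial>v\<close>; the product w of d such combinations is killed by D and
  has the form \<open>z \<circ> F\<close>, so multiplication by L kills the nonzero class of z, which has degree
  \<open>n + 1 - d\<close>. As d may be any number up to \<open>(n + 3) div 2\<close>, L is not injective in degree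
  \<open>k = n div 2\<close>, and by duality not surjective from degree k to degree k + 1.
*)

theory Submission
  imports Defs
begin

section \<open>The pairing attached to a form\<close>

abbreviation lookup where "lookup \<equiv> Poly_Mapping.lookup"
abbreviation keys where "keys \<equiv> Poly_Mapping.keys"
abbreviation single where "single \<equiv> Poly_Mapping.single"

section \<open>Coefficients of iterated partial derivatives\<close>

lemma poly_eq_sum_single:
  fixes p :: "'a \<Rightarrow>\<^sub>0 'b::comm_monoid_add"
  shows "(\<Sum>t\<in>keys p. single t (lookup p t)) = p"
  by (rule poly_mapping_eqI)
     (auto simp: lookup_sum lookup_single when_def in_keys_iff)

lemma Const_mult_single: "Const c * single t a = single t (c * a)"
  by (simp add: Const_def mult_single)

lemma lookup_Const_mult [simp]: "lookup (Const c * p) t = c * lookup p t"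
proof -
  have "Const c * p = (\<Sum>s\<in>keys p. single s (c * lookup p s))"
    by (subst (1) poly_eq_sum_single[symmetric]) (simp add: sum_distrib_left Const_mult_single)
  then show ?thesis
    by (auto simp: lookup_sum lookup_single when_def in_keys_iff)
qed

text \<open>The multifactorial t!, taken in the coefficient ring: it is what the monomial t yields
  when it acts on itself.\<close>

definition monom_fact :: "'v monom \<Rightarrow> 'k::comm_ring_1" where
  "monom_fact t = of_nat (\<Prod>v\<in>keys t. fact (lookup t v))"

lemma monom_fact_superset:
  assumes "finite A" "keys t \<subseteq> A"
  shows "monom_fact t = of_nat (\<Prod>v\<in>A. fact (lookup t v))"
  unfolding monom_fact_def using assms
  by (intro arg_cong[where f = of_nat] prod.mono_neutral_left) (auto simp: in_keys_iff)

lemma monom_fact_nonzero [simp]: "monom_fact t \<noteq> (0::'k::field_char_0)"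
  by (simp add: monom_fact_def)

text \<open>The a-fold derivative contributes the quotient (t_v + a)! / t_v!. Keeping one factorial
  on each side avoids the division, so the identity makes sense over any commutative ring.\<close>

lemma lookup_funpow_partial_deriv:
  "of_nat (fact (lookup t v)) * lookup ((partial_deriv v ^^ a) p) t =
     of_nat (fact (lookup t v + a)) * lookup p (t + single v a)"
proof (induction a arbitrary: t)
  case (Suc a)
  have 1: "t + single v 1 + single v a = t + single v (Suc a)"
    by (simp add: single_add[symmetric] add.assoc)
  have "of_nat (fact (lookup t v)) * lookup ((partial_deriv v ^^ Suc a) p) t =
    of_nat (fact (lookup (t + single v 1) v)) * lookup ((partial_deriv v ^^ a) p) (t + single v 1)"
    by (simp add: lookup_partial_deriv lookup_add algebra_simps)
  also have "\<dots> = of_nat (fact (lookup t v + Suc a)) * lookup p (t + single v (Suc a))"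
    unfolding Suc 1 by (simp add: lookup_add)
  finally show ?case .
qed simp

text \<open>\<open>t\<close> stays general in the induction on \<open>A\<close>: peeling off v
  shifts t at v only, so the factorials at the other variables of \<open>A\<close> are
  unaffected.\<close>

lemma lookup_fold_partial_deriv:
  fixes p :: "('v, 'k::comm_ring_1) mpoly"
  assumes "finite A"
  shows "of_nat (\<Prod>v\<in>A. fact (lookup t v)) *
      lookup (Finite_Set.fold (\<lambda>v. partial_deriv v ^^ lookup s v) p A) t =
    of_nat (\<Prod>v\<in>A. fact (lookup t v + lookup s v)) * lookup p (t + (\<Sum>v\<in>A. single v (lookup s v)))"
  using assms
proof (induction A arbitrary: t)
  case (insert v A)
  interpret comp_fun_commute "\<lambda>v. (partial_deriv v :: ('v, 'k) mpoly \<Rightarrow> _) ^^ lookup s v"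
    by (rule monom_act_commute)
  let ?f = "Finite_Set.fold (\<lambda>v. partial_deriv v ^^ lookup s v) p"
  let ?t = "t + single v (lookup s v)"
  have t: "lookup ?t w = lookup t w" if "w \<in> A" for w
    using that insert.hyps by (auto simp: lookup_add lookup_single when_def)
  have "of_nat (\<Prod>v\<in>insert v A. fact (lookup t v)) * lookup (?f (insert v A)) t =
    of_nat (\<Prod>v\<in>A. fact (lookup t v)) *
      (of_nat (fact (lookup t v)) * lookup ((partial_deriv v ^^ lookup s v) (?f A)) t)"
    using insert.hyps by (simp add: mult_ac)
  also have "\<dots> = of_nat (fact (lookup t v + lookup s v)) *
      (of_nat (\<Prod>w\<in>A. fact (lookup ?t w)) * lookup (?f A) ?t)"
    unfolding lookup_funpow_partial_deriv using t by (simp add: mult_ac)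
  also have "\<dots> = of_nat (fact (lookup t v + lookup s v)) *
      (of_nat (\<Prod>w\<in>A. fact (lookup t w + lookup s w)) * lookup p (?t + (\<Sum>v\<in>A. single v (lookup s v))))"
    unfolding insert.IH using t by simp
  finally show ?case
    using insert.hyps by (simp add: add_ac mult_ac)
qed simp

text \<open>The fold touches only the variables of s. At the remaining variables of t the exponents
  of t and s + t agree, so their factorials can be inserted on both sides.\<close>

lemma lookup_monom_act:
  "monom_fact t * lookup (monom_act s p) t = monom_fact (s + t) * lookup p (s + t)"
proof -
  let ?A = "keys s" and ?B = "keys t - keys s"
  have fin: "finite (?A \<union> ?B)" by simp
  have sub: "keys t \<subseteq> ?A \<union> ?B" "keys (s + t) \<subseteq> ?A \<union> ?B"
    using Poly_Mapping.keys_add[of s t] by auto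
  have disj: "?A \<inter> ?B = {}" by auto
  have B: "(\<Prod>v\<in>?B. fact (lookup (s + t) v)) = (\<Prod>v\<in>?B. fact (lookup t v) :: nat)"
    by (intro prod.cong) (auto simp: lookup_add in_keys_iff)
  have "monom_fact t * lookup (monom_act s p) t = of_nat (\<Prod>v\<in>?B. fact (lookup t v)) *
      (of_nat (\<Prod>v\<in>?A. fact (lookup t v)) * lookup (monom_act s p) t)"
    unfolding monom_fact_superset[OF fin sub(1)]
      prod.union_disjoint[OF finite_keys finite_Diff[OF finite_keys] disj]
    by (simp add: mult_ac)
  also have "\<dots> = of_nat (\<Prod>v\<in>?B. fact (lookup (s + t) v)) *
      (of_nat (\<Prod>v\<in>?A. fact (lookup (s + t) v)) * lookup p (s + t))"
    unfolding monom_act_def B lookup_fold_partial_deriv[OF finite_keys] poly_eq_sum_single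
    by (simp add: lookup_add add_ac)
  also have "\<dots> = monom_fact (s + t) * lookup p (s + t)"
    unfolding monom_fact_superset[OF fin sub(2)]
      prod.union_disjoint[OF finite_keys finite_Diff[OF finite_keys] disj]
    by (simp add: mult_ac)
  finally show ?thesis .
qed

text \<open>The functional \<phi> attached to F; its value at g is the constant term of g acting on
  F.\<close>

definition pairing :: "('v, 'k::comm_ring_1) mpoly \<Rightarrow> ('v, 'k) mpoly \<Rightarrow> 'k" where
  "pairing F g = (\<Sum>t\<in>keys F. monom_fact t * lookup F t * lookup g t)"

lemma pairing_zero [simp]: "pairing F 0 = 0"
  by (simp add: pairing_def)

lemma pairing_add: "pairing F (g + h) = pairing F g + pairing F h"
  by (simp add: pairing_def lookup_add distrib_left sum.distrib)

lemma pairing_diff: "pairing F (g - h) = pairing F g - pairing F h"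
  by (simp add: pairing_def lookup_minus right_diff_distrib sum_subtractf)

lemma pairing_sum: "pairing F (\<Sum>i\<in>A. g i) = (\<Sum>i\<in>A. pairing F (g i))"
  by (induction A rule: infinite_finite_induct) (auto simp: pairing_add)

lemma pairing_Const_mult: "pairing F (Const c * g) = c * pairing F g"
  by (simp add: pairing_def sum_distrib_left mult.left_commute)

lemma pairing_single: "pairing F (single s a) = monom_fact s * lookup F s * a"
  by (auto simp: pairing_def lookup_single when_def in_keys_iff if_distrib cong: if_cong)

text \<open>Any finite superset of the support is allowed as index set, so that a polynomial and its
  homogeneous components can be summed over the same set.\<close>

lemma pairing_mult_single_eq_sum:
  assumes "finite A" "keys g \<subseteq> A"
  shows "pairing F (g * single t 1) = (\<Sum>s\<in>A. lookup g s * (monom_fact (s + t) * lookup F (s + t)))"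
proof -
  have "g * single t 1 = (\<Sum>s\<in>keys g. single (s + t) (lookup g s))"
    by (subst (1) poly_eq_sum_single[symmetric]) (simp add: sum_distrib_right mult_single)
  then have "pairing F (g * single t 1) =
      (\<Sum>s\<in>keys g. lookup g s * (monom_fact (s + t) * lookup F (s + t)))"
    by (simp add: pairing_sum pairing_single mult_ac)
  also have "\<dots> = (\<Sum>s\<in>A. lookup g s * (monom_fact (s + t) * lookup F (s + t)))"
    using assms by (intro sum.mono_neutral_left) (auto simp: in_keys_iff)
  finally show ?thesis .
qed

text \<open>\<phi> recovers every coefficient of g acting on F up to the factor t!, which turns the
  annihilator into a condition on \<phi>.\<close>

lemma pairing_mult_single:
  "pairing F (g * single t 1) = monom_fact t * lookup (poly_act g F) t"
  unfolding pairing_mult_single_eq_sum[OF finite_keys subset_refl] lookup_monom_act[symmetric]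
    poly_act_def lookup_sum lookup_Const_mult sum_distrib_left
  by (simp add: mult_ac)

section \<open>Carriers of polynomial rings, and the annihilator in terms of the pairing\<close>

lemma carrier_poly_ring: "p \<in> carrier (poly_ring V) \<longleftrightarrow> keys p \<subseteq> monoms V"
  by (simp add: poly_ring_def)

lemma poly_ring_simps [simp]:
  "p \<otimes>\<^bsub>poly_ring V\<^esub> q = p * q" "p \<oplus>\<^bsub>poly_ring V\<^esub> q = p + q"
  "\<zero>\<^bsub>poly_ring V\<^esub> = 0" "\<one>\<^bsub>poly_ring V\<^esub> = 1"
  by (simp_all add: poly_ring_def)

lemma poly_ring_closed:
  fixes p q :: "('v, 'k::comm_ring_1) mpoly"
  shows "(0 :: ('v, 'k) mpoly) \<in> carrier (poly_ring V)" "(1 :: ('v, 'k) mpoly) \<in> carrier (poly_ring V)"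
  "p \<in> carrier (poly_ring V) \<Longrightarrow> q \<in> carrier (poly_ring V) \<Longrightarrow> p + q \<in> carrier (poly_ring V)"
  "p \<in> carrier (poly_ring V) \<Longrightarrow> q \<in> carrier (poly_ring V) \<Longrightarrow> p * q \<in> carrier (poly_ring V)"
  "p \<in> carrier (poly_ring V) \<Longrightarrow> q \<in> carrier (poly_ring V) \<Longrightarrow> p - q \<in> carrier (poly_ring V)"
  "p \<in> carrier (poly_ring V) \<Longrightarrow> - p \<in> carrier (poly_ring V)"
proof -
  interpret cring "poly_ring V :: ('v, 'k) mpoly ring" by (rule cring_poly_ring)
  show "(0 :: ('v, 'k) mpoly) \<in> carrier (poly_ring V)" "(1 :: ('v, 'k) mpoly) \<in> carrier (poly_ring V)"
    using zero_closed one_closed by simp_all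
  show "p + q \<in> carrier (poly_ring V)" "p * q \<in> carrier (poly_ring V)"
    if "p \<in> carrier (poly_ring V)" "q \<in> carrier (poly_ring V)"
    using add.m_closed[OF that] m_closed[OF that] by simp_all
  show "- p \<in> carrier (poly_ring V)" if "p \<in> carrier (poly_ring V)"
    using that by (simp add: carrier_poly_ring)
  show "p - q \<in> carrier (poly_ring V)"
    if "p \<in> carrier (poly_ring V)" "q \<in> carrier (poly_ring V)"
    using that keys_diff[of p q] by (auto simp: carrier_poly_ring)
qed

lemma single_in_carrier: "t \<in> monoms V \<Longrightarrow> single t a \<in> carrier (poly_ring V)"
  by (simp add: carrier_poly_ring)

lemma Const_in_carrier: "Const c \<in> carrier (poly_ring V)"
  unfolding Const_def by (rule single_in_carrier) (simp add: monoms_def)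

lemma monoms_add_iff: "s + t \<in> monoms V \<longleftrightarrow> s \<in> monoms V \<and> t \<in> monoms V"
  by (auto simp: monoms_def subset_iff in_keys_iff lookup_add)

lemma pairing_mult_eq_0I:
  assumes "\<And>t. t \<in> keys h \<Longrightarrow> pairing F (g * single t 1) = 0"
  shows "pairing F (g * h) = 0"
proof -
  have "g * h = (\<Sum>t\<in>keys h. Const (lookup h t) * (g * single t 1))"
    by (subst (1) poly_eq_sum_single[symmetric])
       (simp add: sum_distrib_left mult.left_commute[of _ g] Const_mult_single)
  then show ?thesis
    using assms by (simp add: pairing_sum pairing_Const_mult)
qed

text \<open>Characteristic zero makes t! nonzero, so a coefficient of g acting on F vanishes exactly
  when the corresponding pairing does.\<close>

lemma Ann_iff_pairing_single:
  fixes F :: "('v, 'k::field_char_0) mpoly"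
  assumes "F \<in> carrier (poly_ring V)"
  shows "g \<in> Ann V F \<longleftrightarrow> g \<in> carrier (poly_ring V) \<and>
    (\<forall>t\<in>monoms V. pairing F (g * single t 1) = 0)"
proof -
  \<comment> \<open>Every multiple of such a t involves a variable outside V and so is no term of
    F.\<close>
  have *: "lookup (poly_act g F) t = 0" if "t \<notin> monoms V" for t
  proof -
    have "monom_fact t * lookup (monom_act s F) t = 0" for s
      using that assms unfolding lookup_monom_act
      by (auto simp: carrier_poly_ring subset_iff in_keys_iff monoms_add_iff)
    then show ?thesis
      unfolding poly_act_def lookup_sum by (intro sum.neutral) simp
  qed
  have "poly_act g F = 0 \<longleftrightarrow> (\<forall>t\<in>monoms V. pairing F (g * single t 1) = 0)"
    unfolding pairing_mult_single using * by (auto intro!: poly_mapping_eqI)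
  then show ?thesis by (simp add: Ann_def)
qed

lemma Ann_iff_pairing:
  fixes F :: "('v, 'k::field_char_0) mpoly"
  assumes "F \<in> carrier (poly_ring V)"
  shows "g \<in> Ann V F \<longleftrightarrow> g \<in> carrier (poly_ring V) \<and>
    (\<forall>h\<in>carrier (poly_ring V). pairing F (g * h) = 0)"
  unfolding Ann_iff_pairing_single[OF assms]
  by (auto intro: pairing_mult_eq_0I single_in_carrier simp: carrier_poly_ring subset_iff)

section \<open>Macaulay's theorem\<close>

text \<open>The dimensions along the chain attain a minimum, and nested subspaces of equal finite
  dimension coincide.\<close>

lemma (in vector_space) subspace_chain_stabilizes:
  fixes S :: "nat \<Rightarrow> 'b set"
  assumes sub: "\<And>i. subspace (S i)" and dec: "\<And>i. S (Suc i) \<subseteq> S i"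
    and fin: "finite B" "S 0 \<subseteq> span B"
  shows "\<exists>k. \<forall>i\<ge>k. S i = S k"
proof -
  have anti: "S j \<subseteq> S i" if "i \<le> j" for i j
    using lift_Suc_antimono_le[of S, OF dec that] .
  have *: "dim (S j) \<le> dim (S i) \<and> (dim (S j) = dim (S i) \<longrightarrow> S j = S i)" if le: "i \<le> j" for i j
  proof -
    obtain b where b: "b \<subseteq> S j" "independent b" "S j \<subseteq> span b"
      using maximal_independent_subset by blast
    \<comment> \<open>A basis of the smaller subspace is extended to one of the larger; equal
      cardinalities then make the two bases equal.\<close>
    obtain b' where b': "b \<subseteq> b'" "b' \<subseteq> S i" "independent b'" "S i \<subseteq> span b'"
      using maximal_independent_subset_extend[of b "S i"] b anti[OF le] by blast
    have "finite b'"
      using independent_span_bound[OF fin(1) b'(3)] b'(2) fin(2) anti[of 0 i] by auto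
    moreover have "card b = dim (S j)" "card b' = dim (S i)"
      using basis_card_eq_dim b b' by auto
    moreover have "span b \<subseteq> S j"
      using span_minimal[OF b(1) sub] .
    ultimately show ?thesis
      using b b' anti[OF le] card_mono card_subset_eq by (metis subset_antisym subset_trans)
  qed
  obtain k where k: "\<And>i. dim (S k) \<le> dim (S i)"
    using ex_has_least_nat[of "\<lambda>_. True" 0 "\<lambda>i. dim (S i)"] by auto
  show ?thesis
    using * k by (metis le_antisym)
qed

section \<open>Degrees and homogeneous components\<close>

lemma mdeg_superset:
  assumes "finite A" "keys t \<subseteq> A"
  shows "mdeg t = (\<Sum>v\<in>A. lookup t v)"
  unfolding mdeg_def using assms by (intro sum.mono_neutral_left) (auto simp: in_keys_iff)

lemma mdeg_add: "mdeg (s + t) = mdeg s + mdeg t"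
proof -
  let ?A = "keys s \<union> keys t"
  have "mdeg (s + t) = (\<Sum>v\<in>?A. lookup (s + t) v)" "mdeg s = (\<Sum>v\<in>?A. lookup s v)"
    "mdeg t = (\<Sum>v\<in>?A. lookup t v)"
    using Poly_Mapping.keys_add[of s t] by (auto intro!: mdeg_superset)
  then show ?thesis by (simp add: lookup_add sum.distrib)
qed

lemma mdeg_zero [simp]: "mdeg 0 = 0"
  by (simp add: mdeg_def)

lemma mdeg_single [simp]: "mdeg (single v a) = a"
  by (simp add: mdeg_def)

lemma mdeg_sum: "mdeg (\<Sum>i\<in>A. f i) = (\<Sum>i\<in>A. mdeg (f i))"
  by (induction A rule: infinite_finite_induct) (auto simp: mdeg_add)

lemma mdeg_eq_0_iff: "mdeg t = 0 \<longleftrightarrow> t = 0"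
  by (auto simp: mdeg_def in_keys_iff intro!: poly_mapping_eqI)

lemma finite_monoms_mdeg_le:
  assumes "finite V"
  shows "finite {t \<in> monoms V. mdeg t \<le> e}"
proof (rule finite_imageD)
  have "lookup t v \<le> mdeg t" for t :: "'a monom" and v
    by (cases "v \<in> keys t") (auto simp: mdeg_def in_keys_iff intro: member_le_sum)
  then have "lookup ` {t \<in> monoms V. mdeg t \<le> e} \<subseteq>
      {f. \<forall>v. (v \<in> V \<longrightarrow> f v \<in> {..e}) \<and> (v \<notin> V \<longrightarrow> f v = 0)}"
    by (auto simp: monoms_def subset_iff in_keys_iff intro: le_trans)
  then show "finite (lookup ` {t \<in> monoms V. mdeg t \<le> e})"
    by (rule finite_subset) (intro finite_set_of_finite_funs assms finite_atMost)
qed (auto simp: inj_on_def poly_mapping_eqI)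

lemma lookup_hom_component:
  "lookup (hom_component d p) t = (if mdeg t = d then lookup p t else 0)"
  by (auto simp: hom_component_def lookup_sum lookup_single when_def in_keys_iff)

lemma hom_component_in_carrier:
  "p \<in> carrier (poly_ring V) \<Longrightarrow> hom_component d p \<in> carrier (poly_ring V)"
  by (auto simp: carrier_poly_ring subset_iff in_keys_iff lookup_hom_component)

lemma keys_single_mult:
  fixes g :: "('v, 'k::comm_ring_1) mpoly"
  assumes "r \<in> keys (g * single t a)"
  obtains s where "s \<in> keys g" "r = s + t"
  using assms keys_mult[of g "single t a"] by (auto split: if_splits)

lemma lookup_eq_0_if_mdeg_neq: "F \<in> forms V e \<Longrightarrow> mdeg t \<noteq> e \<Longrightarrow> lookup F t = 0"
  by (auto simp: forms_def in_keys_iff)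

text \<open>F lives in the single degree e, so pairing against t sees only the terms of p of degree
  e minus the degree of t. This makes the annihilator homogeneous.\<close>

lemma pairing_hom_component:
  assumes "F \<in> forms V e"
  shows "pairing F (hom_component d p * single t 1) =
    (if d + mdeg t = e then pairing F (p * single t 1) else 0)"
proof -
  have "keys (hom_component d p) \<subseteq> keys p"
    by (auto simp: in_keys_iff lookup_hom_component split: if_splits)
  then have "pairing F (hom_component d p * single t 1) =
      (\<Sum>s\<in>keys p. lookup (hom_component d p) s * (monom_fact (s + t) * lookup F (s + t)))"
    by (intro pairing_mult_single_eq_sum) auto
  also have "\<dots> = (\<Sum>s\<in>keys p. if d + mdeg t = e then lookup p s * (monom_fact (s + t) * lookup F (s + t)) else 0)"
    using lookup_eq_0_if_mdeg_neq[OF assms]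
    by (intro sum.cong) (auto simp: lookup_hom_component mdeg_add)
  also have "\<dots> = (if d + mdeg t = e then pairing F (p * single t 1) else 0)"
    by (auto simp: pairing_mult_single_eq_sum[OF finite_keys subset_refl])
  finally show ?thesis .
qed

section \<open>Residue classes modulo an ideal\<close>

lemma poly_ring_minus:
  fixes p q :: "('v, 'k::comm_ring_1) mpoly"
  assumes "p \<in> carrier (poly_ring V)" "q \<in> carrier (poly_ring V)"
  shows "p \<ominus>\<^bsub>poly_ring V\<^esub> q = p - q"
proof -
  interpret cring "poly_ring V :: ('v, 'k) mpoly ring" by (rule cring_poly_ring)
  have "\<ominus>\<^bsub>poly_ring V\<^esub> q = - q"
    using assms by (intro minus_equality) (auto simp: poly_ring_closed)
  then show ?thesis by (simp add: a_minus_def)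
qed

lemma quot_class_eq_iff:
  fixes p q :: "('v, 'k::comm_ring_1) mpoly"
  assumes "ideal I (poly_ring V)" "p \<in> carrier (poly_ring V)" "q \<in> carrier (poly_ring V)"
  shows "quot_class V I p = quot_class V I q \<longleftrightarrow> p - q \<in> I"
proof -
  interpret cring "poly_ring V :: ('v, 'k) mpoly ring" by (rule cring_poly_ring)
  show ?thesis
    using quotient_eq_iff_same_a_r_cos[OF assms] poly_ring_minus[OF assms(2,3)]
    by (simp add: quot_class_def)
qed

lemma quot_class_0: "ideal I (poly_ring V) \<Longrightarrow> quot_class V I 0 = I"
  unfolding quot_class_def
  by (metis abelian_subgroup.a_rcos_const abelian_subgroupI3 additive_subgroup.zero_closed
      ideal.axioms(1) ideal_def poly_ring_simps(3) ring.is_abelian_group)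

lemma quot_zero: "\<zero>\<^bsub>poly_ring V Quot I\<^esub> = I"
  by (simp add: FactRing_def)

lemma quot_class_eq_zero_iff:
  fixes p :: "('v, 'k::comm_ring_1) mpoly"
  assumes "ideal I (poly_ring V)" "p \<in> carrier (poly_ring V)"
  shows "quot_class V I p = I \<longleftrightarrow> p \<in> I"
  using quot_class_eq_iff[OF assms poly_ring_closed(1)] quot_class_0[OF assms(1)] by simp

lemma quot_class_mult:
  assumes "ideal I (poly_ring V)" "p \<in> carrier (poly_ring V)" "q \<in> carrier (poly_ring V)"
  shows "quot_class V I p \<otimes>\<^bsub>poly_ring V Quot I\<^esub> quot_class V I q = quot_class V I (p * q)"
  using ideal.rcoset_mult_add[OF assms] by (simp add: FactRing_def quot_class_def)

lemma quot_class_add: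
  assumes "ideal I (poly_ring V)" "p \<in> carrier (poly_ring V)" "q \<in> carrier (poly_ring V)"
  shows "quot_class V I p \<oplus>\<^bsub>poly_ring V Quot I\<^esub> quot_class V I q = quot_class V I (p + q)"
  using ring_hom_add[OF ideal.rcos_ring_hom[OF assms(1)] assms(2,3)] by (simp add: quot_class_def)

lemma carrier_quot: "carrier (poly_ring V Quot I) = quot_class V I ` carrier (poly_ring V)"
  by (auto simp: FactRing_def A_RCOSETS_def' quot_class_def)

lemma forms_in_carrier: "p \<in> forms V d \<Longrightarrow> p \<in> carrier (poly_ring V)"
  by (simp add: forms_def)

lemma ideal_closed:
  assumes "ideal I (poly_ring V)"
  shows "p \<in> I \<Longrightarrow> q \<in> carrier (poly_ring V) \<Longrightarrow> p * q \<in> I" "I \<subseteq> carrier (poly_ring V)"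
  using ideal.I_r_closed[OF assms] additive_subgroup.a_subset[OF ideal.axioms(1)[OF assms]]
  by auto

lemma idealI_poly_ring:
  fixes I :: "('v, 'k::comm_ring_1) mpoly set"
  assumes "I \<subseteq> carrier (poly_ring V)" "0 \<in> I" "\<And>p q. p \<in> I \<Longrightarrow> q \<in> I \<Longrightarrow> p + q \<in> I"
    "\<And>p q. p \<in> I \<Longrightarrow> q \<in> carrier (poly_ring V) \<Longrightarrow> p * q \<in> I"
  shows "ideal I (poly_ring V)"
proof (rule idealI)
  interpret cring "poly_ring V :: ('v, 'k) mpoly ring" by (rule cring_poly_ring)
  show "ring (poly_ring V :: ('v, 'k) mpoly ring)" by (rule ring_axioms)
  have neg: "\<ominus>\<^bsub>poly_ring V\<^esub> p \<in> I" if "p \<in> I" for p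
  proof -
    have "\<ominus>\<^bsub>poly_ring V\<^esub> p = p * (- 1)"
      using that assms(1) by (intro minus_equality) (auto simp: poly_ring_closed)
    then show ?thesis
      using assms(4)[OF that poly_ring_closed(6)[OF poly_ring_closed(2)]] by simp
  qed
  show "subgroup I (add_monoid (poly_ring V))"
    using assms neg by (intro add.subgroupI) (auto simp: a_inv_def[symmetric])
  show "x \<otimes>\<^bsub>poly_ring V\<^esub> a \<in> I" "a \<otimes>\<^bsub>poly_ring V\<^esub> x \<in> I" if "a \<in> I" "x \<in> carrier (poly_ring V)" for a x
    using assms(4)[OF that] by (simp_all add: mult.commute)
qed

section \<open>The algebra defined by the annihilator of a form\<close>

context
  fixes V :: "'v set" and F :: "('v, 'k::field_char_0) mpoly" and e :: nat
  assumes F: "F \<in> forms V e"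
begin

lemma Ann_iff: "g \<in> Ann V F \<longleftrightarrow> g \<in> carrier (poly_ring V) \<and>
    (\<forall>t\<in>monoms V. pairing F (g * single t 1) = 0)"
  using Ann_iff_pairing_single[OF forms_in_carrier[OF F]] .

lemma pairing_Ann_mult: "g \<in> Ann V F \<Longrightarrow> h \<in> carrier (poly_ring V) \<Longrightarrow> pairing F (g * h) = 0"
  using Ann_iff_pairing[OF forms_in_carrier[OF F]] by blast

lemma ideal_Ann: "ideal (Ann V F) (poly_ring V)"
  unfolding Ann_iff_pairing[OF forms_in_carrier[OF F]]
  by (rule idealI_poly_ring)
     (auto simp: Ann_iff_pairing[OF forms_in_carrier[OF F]] poly_ring_closed mult.assoc
        distrib_right pairing_add)

lemma homogeneous_ideal_Ann: "homogeneous_ideal V (Ann V F)"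
  using ideal_Ann by (auto simp: homogeneous_ideal_def Ann_iff hom_component_in_carrier
      pairing_hom_component[OF F])

text \<open>Every product of such a g with a monomial stays above degree e, where F has no terms.
  Hence monomials of degree at most e span the quotient.\<close>

lemma high_degree_in_Ann:
  assumes "g \<in> carrier (poly_ring V)" "\<And>t. t \<in> keys g \<Longrightarrow> mdeg t > e"
  shows "g \<in> Ann V F"
proof -
  have "lookup F (s + t) = 0" if "s \<in> keys g" for s t
    using lookup_eq_0_if_mdeg_neq[OF F, of "s + t"] assms(2)[OF that] by (simp add: mdeg_add)
  then show ?thesis
    unfolding Ann_iff pairing_mult_single_eq_sum[OF finite_keys subset_refl]
    using assms(1) by simp
qed

text \<open>Ideals of the quotient are traded for subspaces of the finite-dimensional space of
  polynomials of degree at most e, where descending chains stop.\<close>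

lemma artinian_Ann:
  assumes "finite V"
  shows "artinian_ring (poly_ring V Quot Ann V F)"
  unfolding artinian_ring_def
proof (intro conjI allI impI)
  let ?I = "Ann V F" and ?R = "poly_ring V :: ('v, 'k) mpoly ring"
  let ?Q = "?R Quot ?I"
  interpret I: ideal ?I ?R by (rule ideal_Ann)
  show "ring ?Q" by (rule I.quotient_is_ring)
  fix J :: "nat \<Rightarrow> ('v, 'k) mpoly set set"
  assume J: "\<forall>i. ideal (J i) ?Q \<and> J (Suc i) \<subseteq> J i"
  interpret vector_space "\<lambda>c (p :: ('v, 'k) mpoly). Const c * p"
    by standard (simp_all add: distrib_left distrib_right Const_def single_add mult_single
        mult.assoc[symmetric])
  define B where "B = {t \<in> monoms V. mdeg t \<le> e}"
  have finB: "finite B" unfolding B_def using finite_monoms_mdeg_le[OF assms] .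
  \<comment> \<open>The preimage of \<open>J i\<close> among polynomials of degree at most e;
    \<open>J_eq\<close> shows that it determines \<open>J i\<close>.\<close>
  define S where "S i = {p. keys p \<subseteq> B \<and> quot_class V ?I p \<in> J i}" for i
  have carr: "p \<in> carrier ?R" if "keys p \<subseteq> B" for p :: "('v, 'k) mpoly"
    using that by (auto simp: B_def carrier_poly_ring)
  have sub: "subspace (S i)" for i
  proof -
    interpret J: ideal "J i" ?Q using J by blast
    show ?thesis
      unfolding subspace_def
    proof (intro conjI ballI allI)
      show "0 \<in> S i"
        using additive_subgroup.zero_closed[OF J.is_additive_subgroup] by (simp add: S_def quot_class_0[OF ideal_Ann] quot_zero)
      show "p + q \<in> S i" if "p \<in> S i" "q \<in> S i" for p q
      proof -
        have "quot_class V ?I p \<oplus>\<^bsub>?Q\<^esub> quot_class V ?I q \<in> J i"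
          using that by (intro additive_subgroup.a_closed[OF J.is_additive_subgroup]) (auto simp: S_def)
        then show ?thesis
          using that Poly_Mapping.keys_add[of p q]
          by (auto simp: S_def quot_class_add[OF ideal_Ann] carr)
      qed
      show "Const c * p \<in> S i" if "p \<in> S i" for c p
      proof -
        have "quot_class V ?I (Const c) \<otimes>\<^bsub>?Q\<^esub> quot_class V ?I p \<in> J i"
          using that by (intro J.I_l_closed) (auto simp: S_def carrier_quot Const_in_carrier)
        moreover have "keys (Const c * p) \<subseteq> keys p"
          by (auto simp: in_keys_iff)
        ultimately show ?thesis
          using that by (auto simp: S_def quot_class_mult[OF ideal_Ann] Const_in_carrier carr)
      qed
    qed
  qed
  have "p \<in> span ((\<lambda>t. single t 1) ` B)" if "keys p \<subseteq> B" for p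
  proof -
    have "p = (\<Sum>t\<in>keys p. Const (lookup p t) * single t 1)"
      by (simp add: Const_mult_single poly_eq_sum_single)
    also have "\<dots> \<in> span ((\<lambda>t. single t 1) ` B)"
      using that by (intro span_sum span_scale span_base) auto
    finally show ?thesis .
  qed
  then have span: "S 0 \<subseteq> span ((\<lambda>t. single t 1) ` B)"
    by (auto simp: S_def)
  have "\<exists>k. \<forall>i\<ge>k. S i = S k"
    using J finB by (intro subspace_chain_stabilizes[where S = S, OF sub _ _ span]) (auto simp: S_def)
  then obtain k where k: "\<And>i. i \<ge> k \<Longrightarrow> S i = S k" by blast
  have J_eq: "J i = quot_class V ?I ` S i" for i
  proof
    show "quot_class V ?I ` S i \<subseteq> J i" by (auto simp: S_def)
    show "J i \<subseteq> quot_class V ?I ` S i"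
    proof
      fix a assume a: "a \<in> J i"
      have "J i \<subseteq> carrier ?Q"
        using J ideal.axioms(1) additive_subgroup.a_subset by blast
      then obtain g where g: "g \<in> carrier ?R" "a = quot_class V ?I g"
        using a by (auto simp: carrier_quot)
      \<comment> \<open>Truncating g at degree e changes it only by an element of the
        annihilator.\<close>
      define p where "p = (\<Sum>t\<in>{t\<in>keys g. mdeg t \<le> e}. single t (lookup g t))"
      have p: "lookup p t = (if mdeg t \<le> e then lookup g t else 0)" for t
        by (auto simp: p_def lookup_sum lookup_single when_def in_keys_iff)
      have keys_p: "keys p \<subseteq> B"
        using g(1) by (auto simp: B_def carrier_poly_ring in_keys_iff p split: if_splits)
      have "e < mdeg t" if "t \<in> keys (g - p)" for t
        using that by (simp add: in_keys_iff lookup_minus p split: if_splits)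
      then have "g - p \<in> ?I"
        using poly_ring_closed(5)[OF g(1) carr[OF keys_p]] by (intro high_degree_in_Ann)
      then have "a = quot_class V ?I p"
        using g carr[OF keys_p] quot_class_eq_iff[OF ideal_Ann] by blast
      then show "a \<in> quot_class V ?I ` S i"
        using a keys_p by (auto simp: S_def)
    qed
  qed
  show "\<exists>k. \<forall>i\<ge>k. J i = J k"
    unfolding J_eq using k by blast
qed

text \<open>A socle element pairs to zero with all nonconstant monomials, so its pairing with 1
  determines it modulo the annihilator. A monomial of F pairs nontrivially with 1, hence its class
  spans the socle.\<close>

theorem artinian_gorenstein_Ann:
  assumes "finite V" "F \<noteq> 0"
  shows "artinian_gorenstein V (Ann V F)"
proof -
  let ?I = "Ann V F" and ?R = "poly_ring V :: ('v, 'k) mpoly ring"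
  let ?Q = "?R Quot ?I"
  obtain t0 where t0: "t0 \<in> keys F"
    using assms(2) by (metis keys_eq_empty equals0I)
  have t0_monom: "t0 \<in> monoms V" and t0_deg: "mdeg t0 = e"
    using t0 F by (auto simp: forms_def carrier_poly_ring)
  let ?s = "quot_class V ?I (single t0 1)"
  have in_carrier: "single t0 c \<in> carrier ?R" for c
    using t0_monom by (rule single_in_carrier)
  have pair0: "pairing F (single t0 c) = monom_fact t0 * lookup F t0 * c" for c
    by (rule pairing_single)
  have nz: "pairing F (single t0 1) \<noteq> 0"
    using t0 unfolding pair0 by (simp add: in_keys_iff)
  have s_scaled: "quot_class V ?I (Const c) \<otimes>\<^bsub>?Q\<^esub> ?s = quot_class V ?I (single t0 c)" for c
    by (simp add: quot_class_mult[OF ideal_Ann] in_carrier Const_in_carrier Const_mult_single)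
  have in_socle: "quot_class V ?I (single t0 c) \<in> socle V ?I" for c
    unfolding socle_def
  proof (intro CollectI conjI allI impI ballI)
    show "quot_class V ?I (single t0 c) \<in> carrier ?Q"
      using in_carrier by (auto simp: carrier_quot)
    fix d :: nat and b assume d: "d \<ge> 1" and "b \<in> graded_piece V ?I d"
    then obtain q where q: "q \<in> forms V d" "b = quot_class V ?I q"
      by (auto simp: graded_piece_def)
    have "q * single t0 c \<in> ?I"
    proof (rule high_degree_in_Ann)
      show "q * single t0 c \<in> carrier ?R"
        using q(1) in_carrier by (auto intro: poly_ring_closed forms_in_carrier)
      show "e < mdeg t" if t: "t \<in> keys (q * single t0 c)" for t
      proof -
        obtain r where r: "r \<in> keys q" "t = r + t0"
          using keys_single_mult[OF t] by blast
        then have "mdeg r = d" using q(1) by (simp add: forms_def)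
        then show ?thesis using d t0_deg r(2) by (simp add: mdeg_add)
      qed
    qed
    then show "b \<otimes>\<^bsub>?Q\<^esub> quot_class V ?I (single t0 c) = \<zero>\<^bsub>?Q\<^esub>"
      using q in_carrier forms_in_carrier[OF q(1)]
      by (simp add: quot_zero quot_class_mult[OF ideal_Ann] quot_class_eq_zero_iff[OF ideal_Ann]
          poly_ring_closed)
  qed
  have "single t0 1 \<notin> ?I"
    using nz pairing_Ann_mult[OF _ poly_ring_closed(2), of "single t0 1"] by auto
  then have "?s \<noteq> \<zero>\<^bsub>?Q\<^esub>"
    by (simp add: quot_zero quot_class_eq_zero_iff[OF ideal_Ann] in_carrier)
  moreover have "a \<in> {quot_class V ?I (Const c) \<otimes>\<^bsub>?Q\<^esub> ?s | c. True}" if a: "a \<in> socle V ?I" for a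
  proof -
    obtain g where g: "g \<in> carrier ?R" "a = quot_class V ?I g"
      using a by (auto simp: socle_def carrier_quot)
    \<comment> \<open>This c makes \<open>g - single t0 c\<close> pair to zero with 1.\<close>
    define c where "c = pairing F g / pairing F (single t0 1)"
    have "g - single t0 c \<in> ?I"
      unfolding Ann_iff
    proof (intro conjI ballI)
      show "g - single t0 c \<in> carrier ?R"
        using g in_carrier by (simp add: poly_ring_closed)
      fix t assume t: "t \<in> monoms V"
      show "pairing F ((g - single t0 c) * single t 1) = 0"
      proof (cases "t = 0")
        case True
        have "pairing F (single t0 c) = c * pairing F (single t0 1)"
          by (simp add: pair0)
        then show ?thesis
          using True nz by (simp add: pairing_diff c_def)
      next
        \<comment> \<open>Against a nonconstant t both parts pair to zero: g because t kills its
          class, and t0 because t0 + t exceeds the degree of F.\<close>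
        case False
        then have d: "mdeg t \<ge> 1" by (metis mdeg_eq_0_iff less_one not_le)
        have carr: "single t (1 :: 'k) \<in> carrier ?R" using t by (rule single_in_carrier)
        then have "single t (1 :: 'k) \<in> forms V (mdeg t)"
          by (auto simp: forms_def)
        then have "quot_class V ?I (single t 1) \<otimes>\<^bsub>?Q\<^esub> a = \<zero>\<^bsub>?Q\<^esub>"
          using a d unfolding socle_def graded_piece_def by blast
        then have "single t 1 * g \<in> ?I"
          using g carr
          by (simp add: quot_zero quot_class_mult[OF ideal_Ann] quot_class_eq_zero_iff[OF ideal_Ann]
              poly_ring_closed)
        then have "pairing F (g * single t 1) = 0"
          using pairing_Ann_mult[OF _ poly_ring_closed(2), of "single t 1 * g"]
          by (simp add: mult.commute)
        moreover have "lookup F (t0 + t) = 0"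
          using lookup_eq_0_if_mdeg_neq[OF F] d t0_deg by (simp add: mdeg_add)
        ultimately show ?thesis
          by (simp add: left_diff_distrib pairing_diff mult_single pairing_single)
      qed
    qed
    then have "a = quot_class V ?I (single t0 c)"
      using g in_carrier quot_class_eq_iff[OF ideal_Ann] by blast
    then show ?thesis by (auto simp: s_scaled)
  qed
  ultimately show ?thesis
    unfolding artinian_gorenstein_def
    using assms(1) homogeneous_ideal_Ann artinian_Ann[OF assms(1)] in_socle
    by (intro conjI bexI[of _ ?s]) (auto simp: s_scaled)
qed

end


section \<open>Lexicographic order and quadratic Groebner bases\<close>

text \<open>Monomials are compared at the smallest variable where they differ; for t against 0 this
  is the smallest variable of t, whose exponent is positive.\<close>

lemma zero_le_monom: "(0 :: 'v::linorder monom) \<le> t"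
proof (cases "t = 0")
  case False
  then have ne: "keys t \<noteq> {}" by simp
  let ?k = "Min (keys t)"
  have "lookup t ?k > 0"
    using Min_in[OF finite_keys ne] by (simp add: in_keys_iff)
  moreover have "lookup t v = 0" if "v < ?k" for v
    using that Min_le[OF finite_keys, of v t] by (metis in_keys_iff not_le)
  ultimately have "0 < t"
    by (auto simp: less_poly_mapping.rep_eq less_fun_def)
  then show ?thesis by simp
qed simp

definition lex_on :: "'v::linorder set \<Rightarrow> 'v monom rel" where
  "lex_on V = {(s, t). s \<in> monoms V \<and> t \<in> monoms V \<and> s \<le> t}"

lemma zero_monom: "0 \<in> monoms V"
  by (simp add: monoms_def)

lemma monomial_order_lex_on: "monomial_order V (lex_on V)"
  unfolding monomial_order_def linear_order_on_def partial_order_on_def preorder_on_def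
  by (auto simp: lex_on_def zero_le_monom monoms_add_iff zero_monom refl_on_def trans_on_def
      antisym_on_def total_on_def intro: add_right_mono)

lemma leading_monom_lex_on:
  assumes "p \<in> carrier (poly_ring V)" "p \<noteq> 0"
  shows "leading_monom (lex_on V) p = Max (keys p)"
  unfolding leading_monom_def
proof (rule the_equality)
  have ne: "keys p \<noteq> {}" using assms by simp
  show "Max (keys p) \<in> keys p \<and> (\<forall>s\<in>keys p. (s, Max (keys p)) \<in> lex_on V)"
    using assms ne Max_in[OF finite_keys ne] by (auto simp: lex_on_def carrier_poly_ring subset_iff)
  show "t = Max (keys p)" if "t \<in> keys p \<and> (\<forall>s\<in>keys p. (s, t) \<in> lex_on V)" for t
    using that by (intro Max_eqI[symmetric]) (auto simp: lex_on_def)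
qed

text \<open>Reduces the existence of a quadratic Groebner basis to divisibility between leading
  monomials. The leading monomials of quadrics have degree two, so finitely many occur, and one
  quadric for each of them suffices as a basis.\<close>

lemma G_quadraticI:
  fixes V :: "'v::linorder set" and I :: "('v, 'k::field) mpoly set"
  assumes fin: "finite V" and I: "ideal I (poly_ring V)"
    and divs: "\<And>p. p \<in> I \<Longrightarrow> p \<noteq> 0 \<Longrightarrow>
      \<exists>q\<in>I \<inter> forms V 2. \<exists>u. q \<noteq> 0 \<and> Max (keys p) = Max (keys q) + u"
  shows "G_quadratic V I"
proof -
  let ?R = "poly_ring V :: ('v, 'k) mpoly ring"
  let ?r = "lex_on V"
  interpret cring ?R by (rule cring_poly_ring)
  define Q where "Q = I \<inter> forms V 2 - {0}"
  have I_carrier: "I \<subseteq> carrier ?R" using ideal_closed(2)[OF I] .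
  have in_keys: "Max (keys p) \<in> keys p" if "p \<noteq> 0" for p :: "('v, 'k) mpoly"
    using that by (intro Max_in) auto
  have in_monoms: "Max (keys p) \<in> monoms V" if "p \<in> I" "p \<noteq> 0" for p
    using in_keys[OF that(2)] that(1) I_carrier by (metis carrier_poly_ring subsetD)
  have "(\<lambda>q. Max (keys q)) ` Q \<subseteq> {t \<in> monoms V. mdeg t \<le> 2}"
    using in_keys in_monoms by (fastforce simp: Q_def forms_def)
  then have "finite ((\<lambda>q. Max (keys q)) ` Q)"
    using finite_monoms_mdeg_le[OF fin] finite_subset by blast
  then obtain G where G: "G \<subseteq> Q" "finite G" "(\<lambda>q. Max (keys q)) ` Q = (\<lambda>q. Max (keys q)) ` G"
    using finite_subset_image[of "(\<lambda>q. Max (keys q)) ` Q" "\<lambda>q. Max (keys q)" Q] by auto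
  define LM where "LM P = {single (leading_monom ?r p) (1 :: 'k) | p. p \<in> P \<and> p \<noteq> 0}"
    for P :: "('v, 'k) mpoly set"
  have LM: "LM P = {single (Max (keys p)) 1 | p. p \<in> P \<and> p \<noteq> 0}" if "P \<subseteq> I" for P
    unfolding LM_def using leading_monom_lex_on that I_carrier by (metis (no_types, lifting) subsetD)
  have "G \<subseteq> I" using G(1) by (auto simp: Q_def)
  have LM_carrier: "LM P \<subseteq> carrier ?R" if "P \<subseteq> I" for P
    unfolding LM[OF that] using that in_monoms by (auto intro!: single_in_carrier)
  have ideal_G: "ideal (Idl\<^bsub>?R\<^esub> (LM G)) ?R"
    using genideal_ideal[OF LM_carrier[OF \<open>G \<subseteq> I\<close>]] .
  have "LM G \<subseteq> LM I" unfolding LM_def using \<open>G \<subseteq> I\<close> by blast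
  then have "LM G \<subseteq> Idl\<^bsub>?R\<^esub> (LM I)"
    using genideal_self[OF LM_carrier[OF subset_refl]] by blast
  then have 1: "Idl\<^bsub>?R\<^esub> (LM G) \<subseteq> Idl\<^bsub>?R\<^esub> (LM I)"
    using genideal_minimal[OF genideal_ideal[OF LM_carrier[OF subset_refl]]] by blast
  have "LM I \<subseteq> Idl\<^bsub>?R\<^esub> (LM G)"
  proof
    fix x assume "x \<in> LM I"
    then obtain p where p: "p \<in> I" "p \<noteq> 0" "x = single (Max (keys p)) 1"
      using LM[OF subset_refl] by auto
    obtain q u where q: "q \<in> Q" "Max (keys p) = Max (keys q) + u"
      using divs[OF p(1,2)] by (auto simp: Q_def)
    obtain g where g: "g \<in> G" "Max (keys q) = Max (keys g)"
      using q(1) G(3) by (metis (no_types, lifting) imageE imageI)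
    have "g \<noteq> 0" using g(1) G(1) by (auto simp: Q_def)
    then have "single (Max (keys g)) 1 \<in> LM G"
      using LM[OF \<open>G \<subseteq> I\<close>] g(1) by auto
    then have "single (Max (keys g)) 1 \<in> Idl\<^bsub>?R\<^esub> (LM G)"
      using genideal_self[OF LM_carrier[OF \<open>G \<subseteq> I\<close>]] by blast
    moreover have "u \<in> monoms V"
      using in_monoms[OF p(1,2)] q(2) by (simp add: monoms_add_iff)
    ultimately have "single (Max (keys g)) 1 * single u 1 \<in> Idl\<^bsub>?R\<^esub> (LM G)"
      using ideal_closed(1)[OF ideal_G] single_in_carrier by blast
    then show "x \<in> Idl\<^bsub>?R\<^esub> (LM G)"
      by (simp add: p(3) q(2) g(2) mult_single)
  qed
  then have 2: "Idl\<^bsub>?R\<^esub> (LM I) \<subseteq> Idl\<^bsub>?R\<^esub> (LM G)"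
    using genideal_minimal[OF ideal_G] by blast
  have "groebner_basis V ?r I G"
    unfolding groebner_basis_def initial_ideal_def
    using G(1,2) 1 2 by (auto simp: Q_def LM_def)
  moreover have "G \<subseteq> forms V 2" using G(1) by (auto simp: Q_def)
  ultimately show ?thesis
    unfolding G_quadratic_def using monomial_order_lex_on by blast
qed


section \<open>Independent sets of a whiskered graph\<close>

definition whisker_facet :: "nat \<Rightarrow> nat set \<Rightarrow> nat set" where
  "whisker_facet n S = S \<union> (\<lambda>a. a + n) ` ({1..n} - S)"

lemma independent_set_subset: "S \<in> independent_sets V E \<Longrightarrow> T \<subseteq> S \<Longrightarrow> T \<in> independent_sets V E"
  unfolding independent_sets_def by blast

context
  fixes n :: nat and E :: "nat set set"
  assumes graph: "simple_graph {1..n} E"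
begin

lemma independent_whisker_iff:
  "T \<in> independent_sets {1..2 * n} (whisker n E) \<longleftrightarrow>
    T \<subseteq> {1..2 * n} \<and> T \<inter> {1..n} \<in> independent_sets {1..n} E \<and>
    (\<forall>a\<in>{1..n}. a \<in> T \<longrightarrow> a + n \<notin> T)"
proof -
  have "(\<forall>e\<in>whisker n E. \<not> e \<subseteq> T) \<longleftrightarrow>
      (\<forall>e\<in>E. \<not> e \<subseteq> T) \<and> (\<forall>a\<in>{1..n}. \<not> {a, a + n} \<subseteq> T)"
    unfolding whisker_def by (simp only: ball_Un) blast
  moreover have "e \<subseteq> T \<longleftrightarrow> e \<subseteq> T \<inter> {1..n}" if "e \<in> E" for e
    using graph that by (auto simp: simple_graph_def)
  moreover have "T \<subseteq> {1..2 * n} \<Longrightarrow> T \<inter> {1..n} \<subseteq> {1..n}"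
    by blast
  ultimately show ?thesis
    unfolding independent_sets_def mem_Collect_eq by (metis empty_subsetI inf_le2 insert_subset)
qed

lemma whisker_facet_Int: "S \<subseteq> {1..n} \<Longrightarrow> whisker_facet n S \<inter> {1..n} = S"
  by (auto simp: whisker_facet_def)

text \<open>One vertex is taken from each pair {a, a + n}. That all facets have the same size makes
  the form homogeneous.\<close>

lemma card_whisker_facet:
  assumes "S \<subseteq> {1..n}"
  shows "card (whisker_facet n S) = n"
proof -
  have "finite S" using assms finite_subset by blast
  have "card (whisker_facet n S) = card S + card ((\<lambda>a. a + n) ` ({1..n} - S))"
    unfolding whisker_facet_def using assms \<open>finite S\<close> by (intro card_Un_disjoint) auto
  also have "\<dots> = card S + card ({1..n} - S)"
    by (simp add: card_image)
  also have "\<dots> = n"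
    using assms \<open>finite S\<close> card_mono[OF _ assms] by (simp add: card_Diff_subset)
  finally show ?thesis .
qed

lemma independent_whisker_facet:
  "S \<in> independent_sets {1..n} E \<Longrightarrow>
    whisker_facet n S \<in> independent_sets {1..2 * n} (whisker n E)"
  unfolding independent_whisker_iff
proof (intro conjI ballI impI)
  assume S: "S \<in> independent_sets {1..n} E"
  then have sub: "S \<subseteq> {1..n}" by (simp add: independent_sets_def)
  then show "whisker_facet n S \<inter> {1..n} \<in> independent_sets {1..n} E"
    using S by (simp only: whisker_facet_Int)
  show "whisker_facet n S \<subseteq> {1..2 * n}"
    using sub by (auto simp: whisker_facet_def)
  fix a assume a: "a \<in> {1..n}" "a \<in> whisker_facet n S"
  then have "a \<in> S" using whisker_facet_Int[OF sub] by blast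
  then show "a + n \<notin> whisker_facet n S"
    using a sub by (auto simp: whisker_facet_def)
qed

text \<open>A whisker vertex a + n of T excludes a from T, so it is among the whisker vertices that
  the facet adds.\<close>

lemma independent_subset_whisker_facet:
  assumes "T \<in> independent_sets {1..2 * n} (whisker n E)"
  shows "T \<subseteq> whisker_facet n (T \<inter> {1..n})"
proof
  fix j assume j: "j \<in> T"
  show "j \<in> whisker_facet n (T \<inter> {1..n})"
  proof (cases "j \<le> n")
    case True
    then show ?thesis using j assms by (auto simp: whisker_facet_def independent_sets_def)
  next
    case False
    then have eq: "j = (j - n) + n" and "j - n \<in> {1..n}"
      using j assms by (auto simp: independent_sets_def)
    moreover have "j - n \<notin> T"
      using assms calculation j unfolding independent_whisker_iff by metis
    ultimately have "j \<in> (\<lambda>a. a + n) ` ({1..n} - T \<inter> {1..n})"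
      by blast
    then show ?thesis unfolding whisker_facet_def by blast
  qed
qed

lemma maximal_independent_sets_whisker:
  "maximal_independent_sets {1..2 * n} (whisker n E) =
    whisker_facet n ` independent_sets {1..n} E" (is "?M = ?W")
proof
  show "?M \<subseteq> ?W"
  proof
    fix T assume "T \<in> ?M"
    then have T: "T \<in> independent_sets {1..2 * n} (whisker n E)"
      and max: "\<And>T'. T' \<in> independent_sets {1..2 * n} (whisker n E) \<Longrightarrow> T \<subseteq> T' \<Longrightarrow> T' = T"
      by (auto simp: maximal_independent_sets_def)
    have S: "T \<inter> {1..n} \<in> independent_sets {1..n} E"
      using T independent_whisker_iff by blast
    show "T \<in> ?W"
      using max[OF independent_whisker_facet[OF S] independent_subset_whisker_facet[OF T]] S
      by blast
  qed
  show "?W \<subseteq> ?M"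
  proof
    fix T assume "T \<in> ?W"
    then obtain S where S: "S \<in> independent_sets {1..n} E" "T = whisker_facet n S" by blast
    have "T' = T" if T': "T' \<in> independent_sets {1..2 * n} (whisker n E)" "T \<subseteq> T'" for T'
    proof -
      \<comment> \<open>For a outside S the facet already contains a + n, which bars a from every
        independent superset.\<close>
      have "T' \<inter> {1..n} \<subseteq> S"
      proof
        fix a assume a: "a \<in> T' \<inter> {1..n}"
        then have "a + n \<notin> T" using T' unfolding independent_whisker_iff by blast
        then show "a \<in> S" using a S(2) by (auto simp: whisker_facet_def)
      qed
      moreover have "S \<subseteq> T' \<inter> {1..n}"
        using T'(2) S by (auto simp: whisker_facet_def independent_sets_def)
      ultimately show ?thesis
        using independent_subset_whisker_facet[OF T'(1)] T'(2) S(2) by (metis subset_antisym)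
    qed
    then show "T \<in> ?M"
      using independent_whisker_facet[OF S(1)] S(2) by (auto simp: maximal_independent_sets_def)
  qed
qed

end


section \<open>The form of a facet complex\<close>

text \<open>
  The order on monomials compares exponents at the smallest variable where they differ, so a
  smaller variable weighs more.
\<close>

instantiation graph_var :: linorder
begin

definition less_eq_graph_var :: "graph_var \<Rightarrow> graph_var \<Rightarrow> bool" where
  "less_eq_graph_var v w = (case v of
      U i \<Rightarrow> (case w of U j \<Rightarrow> i \<le> j | X j \<Rightarrow> True)
    | X i \<Rightarrow> (case w of U j \<Rightarrow> False | X j \<Rightarrow> i \<le> j))"

definition less_graph_var :: "graph_var \<Rightarrow> graph_var \<Rightarrow> bool" where
  "less_graph_var v w \<longleftrightarrow> v \<le> w \<and> \<not> w \<le> v"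

instance
  by standard (auto simp: less_eq_graph_var_def less_graph_var_def split: graph_var.splits)

end

lemma less_U_iff: "v < U j \<longleftrightarrow> (\<exists>i<j. v = U i)"
  by (cases v) (auto simp: less_graph_var_def less_eq_graph_var_def)

definition umon :: "nat set \<Rightarrow> graph_var monom" where
  "umon A = (\<Sum>j\<in>A. single (U j) 1)"

definition fmon :: "(nat \<Rightarrow> nat set) \<Rightarrow> nat \<Rightarrow> graph_var monom" where
  "fmon Fs i = single (X i) 1 + umon (Fs i)"

lemma lookup_umon:
  "finite A \<Longrightarrow> lookup (umon A) v = (case v of U j \<Rightarrow> if j \<in> A then 1 else 0 | X i \<Rightarrow> 0)"
  by (cases v) (auto simp: umon_def lookup_sum lookup_single when_def)

lemma umon_Diff: "finite B \<Longrightarrow> A \<subseteq> B \<Longrightarrow> umon B = umon A + umon (B - A)"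
  unfolding umon_def by (metis add.commute sum.subset_diff)

lemma umon_singleton: "umon {j} = single (U j) 1"
  by (simp add: umon_def)

lemma prod_Var: "(\<Prod>j\<in>A. Var (U j)) = single (umon A) (1 :: 'k::comm_ring_1)"
  unfolding umon_def
  by (induction A rule: infinite_finite_induct) (auto simp: Var_def mult_single)

lemma graph_form_eq: "graph_form m Fs = (\<Sum>i=1..m. single (fmon Fs i) (1 :: 'k::comm_ring_1))"
  by (simp add: graph_form_def prod_Var fmon_def) (simp add: Var_def mult_single)

context
  fixes Fs :: "nat \<Rightarrow> nat set" and m :: nat
  assumes fin: "\<forall>i\<in>{1..m}. finite (Fs i)"
begin

lemma lookup_fmon:
  "i \<in> {1..m} \<Longrightarrow> lookup (fmon Fs i) v =
    (case v of U j \<Rightarrow> if j \<in> Fs i then 1 else 0 | X k \<Rightarrow> if k = i then 1 else 0)"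
  using fin by (auto simp: fmon_def lookup_add lookup_umon lookup_single when_def split: graph_var.splits)

text \<open>The variable x_i occurs in the i-th term alone, so the terms never collide and all
  coefficients of the form are 1.\<close>

lemma inj_on_fmon: "inj_on (fmon Fs) {1..m}"
proof (rule inj_onI)
  fix i j assume i: "i \<in> {1..m}" and j: "j \<in> {1..m}" and eq: "fmon Fs i = fmon Fs j"
  have "lookup (fmon Fs i) (X i) = 1"
    by (simp add: lookup_fmon[OF i])
  moreover have "lookup (fmon Fs j) (X i) = (if i = j then 1 else 0)"
    by (simp add: lookup_fmon[OF j])
  ultimately show "i = j"
    using eq by (metis zero_neq_one)
qed

lemma lookup_graph_form:
  "lookup (graph_form m Fs :: (graph_var, 'k::comm_ring_1) mpoly) t =
    (if t \<in> fmon Fs ` {1..m} then 1 else 0)"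
proof (cases "t \<in> fmon Fs ` {1..m}")
  case True
  then obtain i where i: "i \<in> {1..m}" "t = fmon Fs i" by blast
  have "lookup (graph_form m Fs :: (graph_var, 'k) mpoly) t = (\<Sum>j=1..m. if j = i then 1 else 0)"
    unfolding graph_form_eq lookup_sum lookup_single when_def i(2)
    using inj_on_fmon i(1) by (intro sum.cong) (auto dest: inj_onD)
  then show ?thesis using True i(1) by simp
qed (auto simp: graph_form_eq lookup_sum lookup_single when_def intro!: sum.neutral)

text \<open>Facet monomials are squarefree; the factorials therefore disappear from the
  pairing.\<close>

lemma monom_fact_fmon: "i \<in> {1..m} \<Longrightarrow> monom_fact (fmon Fs i) = 1"
  unfolding monom_fact_def
  by (subst prod.neutral) (auto simp: lookup_fmon split: graph_var.splits)

lemma pairing_graph_form_single: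
  "pairing (graph_form m Fs) (single s a) = (if s \<in> fmon Fs ` {1..m} then a else 0)"
  by (auto simp: pairing_single lookup_graph_form monom_fact_fmon)

lemma pairing_graph_form_mult_single:
  "pairing (graph_form m Fs) (g * single t 1) =
    (\<Sum>s\<in>keys g. if s + t \<in> fmon Fs ` {1..m} then lookup g s else 0)"
  unfolding pairing_mult_single_eq_sum[OF finite_keys subset_refl]
  by (intro sum.cong) (auto simp: lookup_graph_form monom_fact_fmon)

lemma graph_form_in_forms:
  assumes "\<And>i. i \<in> {1..m} \<Longrightarrow> Fs i \<subseteq> {1..N} \<and> card (Fs i) = n"
  shows "(graph_form m Fs :: (graph_var, 'k::comm_ring_1) mpoly) \<in> forms (graph_vars m N) (n + 1)"
proof -
  have "fmon Fs i \<in> monoms (graph_vars m N) \<and> mdeg (fmon Fs i) = n + 1" if "i \<in> {1..m}" for i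
  proof
    have "U j \<in> graph_vars m N" if "j \<in> Fs i" for j
      using assms[OF \<open>i \<in> {1..m}\<close>] that unfolding graph_vars_def by blast
    moreover have "X i \<in> graph_vars m N"
      using that by (simp add: graph_vars_def)
    ultimately show "fmon Fs i \<in> monoms (graph_vars m N)"
      by (auto simp: monoms_def in_keys_iff lookup_fmon[OF that] split: graph_var.splits if_splits)
    show "mdeg (fmon Fs i) = n + 1"
      using assms[OF that] by (simp add: fmon_def mdeg_add umon_def mdeg_sum)
  qed
  then show ?thesis
    by (auto simp: forms_def carrier_poly_ring in_keys_iff lookup_graph_form split: if_splits)
qed

text \<open>The variable x_i forces the i-th term, and cancellation then determines the
  cofactor.\<close>

lemma X_umon_add_eq_fmon_iff:
  assumes "i \<in> {1..m}" "A \<subseteq> Fs i" "j \<in> {1..m}"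
  shows "single (X i) 1 + umon A + t = fmon Fs j \<longleftrightarrow> j = i \<and> t = umon (Fs i - A)"
proof -
  have *: "fmon Fs i = single (X i) 1 + umon A + umon (Fs i - A)"
    using umon_Diff[OF bspec[OF fin assms(1)] assms(2)] by (simp add: fmon_def add.assoc)
  have "j = i" if eq: "single (X i) 1 + umon A + t = fmon Fs j"
  proof (rule ccontr)
    assume "j \<noteq> i"
    then have "lookup (fmon Fs j) (X i) = 0" using assms(3) by (simp add: lookup_fmon)
    then show False unfolding eq[symmetric] by (simp add: lookup_add)
  qed
  then show ?thesis using * by auto
qed

text \<open>The complementary monomial singles out u_A, so pairing with it reads off one
  coefficient.\<close>

lemma umon_add_eq_fmon_iff:
  assumes "i \<in> {1..m}" "A \<subseteq> Fs i"
  shows "s + (single (X i) 1 + umon (Fs i - A)) \<in> fmon Fs ` {1..m} \<longleftrightarrow> s = umon A"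
proof -
  have "Fs i - (Fs i - A) = A" using assms(2) by blast
  then show ?thesis
    using X_umon_add_eq_fmon_iff[OF assms(1), of "Fs i - A" _ s] assms(1)
    by (auto simp: add.commute[of s] image_iff)
qed

end


section \<open>Quadratic generators for whiskered graphs\<close>

lemma monom_dvdI:
  fixes s t :: "'v monom"
  assumes "\<And>v. lookup s v \<le> lookup t v"
  shows "t = s + (t - s)"
  using assms by (intro poly_mapping_eqI) (simp add: lookup_add lookup_minus)

lemma keys_single_diff_single:
  fixes s t :: "'v monom"
  shows "s \<noteq> t \<Longrightarrow> keys (single s 1 - single t (1 :: 'k::comm_ring_1)) = {s, t}"
  by (auto simp: in_keys_iff lookup_minus lookup_single when_def split: if_splits)

locale whiskered_graph =
  fixes n m :: nat and E :: "nat set set" and Fs :: "nat \<Rightarrow> nat set"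
  assumes graph: "simple_graph {1..n} E"
    and bij: "bij_betw Fs {1..m} (maximal_independent_sets {1..2 * n} (whisker n E))"
begin

lemma facetE:
  assumes "i \<in> {1..m}"
  obtains S where "S \<in> independent_sets {1..n} E" "Fs i = whisker_facet n S"
    "Fs i \<inter> {1..n} = S"
proof -
  have "Fs i \<in> whisker_facet n ` independent_sets {1..n} E"
    using bij assms unfolding maximal_independent_sets_whisker[OF graph] bij_betw_def by blast
  then obtain S where S: "S \<in> independent_sets {1..n} E" "Fs i = whisker_facet n S" by blast
  moreover have "S \<subseteq> {1..n}" using S(1) by (simp add: independent_sets_def)
  ultimately show ?thesis using that whisker_facet_Int[OF graph] by simp
qed

lemma facet_exists:
  assumes "S \<in> independent_sets {1..n} E"
  obtains i where "i \<in> {1..m}" "Fs i = whisker_facet n S" "Fs i \<inter> {1..n} = S"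
proof -
  have "whisker_facet n S \<in> Fs ` {1..m}"
    using bij assms unfolding maximal_independent_sets_whisker[OF graph] bij_betw_def by blast
  moreover have "S \<subseteq> {1..n}" using assms by (simp add: independent_sets_def)
  ultimately show ?thesis using that whisker_facet_Int[OF graph] by auto
qed

lemma facet_subset: "i \<in> {1..m} \<Longrightarrow> Fs i \<subseteq> {1..2 * n}"
  using bij by (auto simp: bij_betw_def maximal_independent_sets_def independent_sets_def)

lemma finite_facet: "\<forall>i\<in>{1..m}. finite (Fs i)"
  using facet_subset finite_subset by blast

lemma card_facet: "i \<in> {1..m} \<Longrightarrow> card (Fs i) = n"
  by (elim facetE) (simp add: card_whisker_facet[OF graph] independent_sets_def)

text \<open>The whisker part of a facet is determined by its trace on the vertices of H.\<close>

lemma facet_eqI: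
  assumes "i \<in> {1..m}" "j \<in> {1..m}" "Fs i \<inter> {1..n} = Fs j \<inter> {1..n}"
  shows "i = j"
proof -
  have "Fs i = Fs j" using facetE[OF assms(1)] facetE[OF assms(2)] assms(3) by metis
  then show ?thesis using bij assms by (auto simp: bij_betw_def dest: inj_onD)
qed

lemma face_subset_facet:
  assumes "T \<in> independent_sets {1..2 * n} (whisker n E)"
  obtains i where "i \<in> {1..m}" "T \<subseteq> Fs i"
proof -
  have "T \<inter> {1..n} \<in> independent_sets {1..n} E"
    using assms independent_whisker_iff[OF graph] by blast
  then obtain i where "i \<in> {1..m}" "Fs i = whisker_facet n (T \<inter> {1..n})"
    by (rule facet_exists)
  then show ?thesis
    using that independent_subset_whisker_facet[OF graph assms] by simp
qed

lemma facet_independent: "i \<in> {1..m} \<Longrightarrow> Fs i \<in> independent_sets {1..2 * n} (whisker n E)"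
  using bij by (auto simp: bij_betw_def maximal_independent_sets_def)

abbreviation "vars \<equiv> graph_vars m (2 * n)"
abbreviation "facets \<equiv> fmon Fs ` {1..m}"

lemma form_in_forms: "(graph_form m Fs :: (graph_var, 'k::comm_ring_1) mpoly) \<in> forms vars (n + 1)"
  by (rule graph_form_in_forms[OF finite_facet]) (use facet_subset card_facet in auto)

lemma facet_in_monoms:
  assumes "i \<in> {1..m}"
  shows "fmon Fs i \<in> monoms vars"
proof -
  \<comment> \<open>The integers serve as a sample coefficient ring for a claim about monomials
    only.\<close>
  have "lookup (graph_form m Fs :: (graph_var, int) mpoly) (fmon Fs i) = 1"
    unfolding lookup_graph_form[OF finite_facet] using assms by simp
  then have "fmon Fs i \<in> keys (graph_form m Fs :: (graph_var, int) mpoly)"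
    by (simp add: in_keys_iff)
  then show ?thesis
    using forms_in_carrier[OF form_in_forms] unfolding carrier_poly_ring by blast
qed

lemma Ann_form_iff: "g \<in> Ann vars (graph_form m Fs :: (graph_var, 'k::field_char_0) mpoly) \<longleftrightarrow>
    g \<in> carrier (poly_ring vars) \<and>
    (\<forall>t\<in>monoms vars. (\<Sum>s\<in>keys g. if s + t \<in> facets then lookup g s else 0) = 0)"
  unfolding Ann_iff[OF form_in_forms] pairing_graph_form_mult_single[OF finite_facet] ..

text \<open>Such a monomial divides no term of the form.\<close>

lemma monom_in_AnnI:
  assumes "s \<in> monoms vars" "\<And>i. i \<in> {1..m} \<Longrightarrow> \<exists>v. lookup (fmon Fs i) v < lookup s v"
  shows "single s 1 \<in> Ann vars (graph_form m Fs :: (graph_var, 'k::field_char_0) mpoly)"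
proof -
  have "s + t \<noteq> fmon Fs i" if "i \<in> {1..m}" for t i
    using assms(2)[OF that] by (metis lookup_add le_add1 not_le)
  then have "s + t \<notin> facets" for t by blast
  then show ?thesis
    unfolding Ann_form_iff using assms(1) by (simp add: single_in_carrier)
qed

text \<open>Two monomials with the same cofactors in the form have equal pairings with every
  monomial, so their difference pairs to zero.\<close>

lemma binomial_in_AnnI:
  assumes "single s 1 - single s' (1 :: 'k::field_char_0) \<in> carrier (poly_ring vars)" "s \<noteq> s'"
    and "\<And>t. s + t \<in> facets \<longleftrightarrow> s' + t \<in> facets"
  shows "single s 1 - single s' 1 \<in> Ann vars (graph_form m Fs :: (graph_var, 'k) mpoly)"
  unfolding Ann_form_iff keys_single_diff_single[OF assms(2)] using assms
  by (simp add: lookup_minus lookup_single when_def)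

text \<open>Here a is exchanged for its whisker vertex: removing a from F_S and a + n from the facet
  of S - {a} leaves the same set, so x_i u_a and x_j u_(a+n) have the same unique cofactor.\<close>

lemma binomial_in_Ann:
  assumes i: "i \<in> {1..m}" and a: "a \<in> Fs i" "a \<le> n"
  obtains j where "single (single (X i) 1 + single (U a) 1) 1 - single (single (X j) 1 + single (U (a + n)) 1) 1
      \<in> Ann vars (graph_form m Fs :: (graph_var, 'k::field_char_0) mpoly) \<inter> forms vars 2"
proof -
  obtain S where S: "S \<in> independent_sets {1..n} E" "Fs i = whisker_facet n S" "Fs i \<inter> {1..n} = S"
    using i by (rule facetE)
  have a': "a \<in> {1..n}" using a facet_subset[OF i] by auto
  then have "a \<in> S" using S(3) a by blast
  have "S - {a} \<in> independent_sets {1..n} E"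
    using independent_set_subset[OF S(1)] by blast
  then obtain j where j: "j \<in> {1..m}" "Fs j = whisker_facet n (S - {a})"
    by (rule facet_exists)
  have "S \<subseteq> {1..n}" using S(3) by blast
  then have b: "a + n \<in> Fs j" and diff: "Fs i - {a} = Fs j - {a + n}"
    using \<open>a \<in> S\<close> a' unfolding S(2) j(2) whisker_facet_def by auto
  let ?s = "single (X i) 1 + single (U a) (1::nat)" and ?s' = "single (X j) 1 + single (U (a + n)) (1::nat)"
  let ?q = "single ?s 1 - single ?s' (1 :: 'k)"
  have iff: "?s + t \<in> facets \<longleftrightarrow> t = umon (Fs i - {a})"
    "?s' + t \<in> facets \<longleftrightarrow> t = umon (Fs j - {a + n})" for t
    using X_umon_add_eq_fmon_iff[OF finite_facet i, of "{a}" _ t] i a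
      X_umon_add_eq_fmon_iff[OF finite_facet j(1), of "{a + n}" _ t] j(1) b
    by (auto simp: umon_singleton image_iff)
  have "lookup ?s (U a) \<noteq> lookup ?s' (U a)"
    using a' by (auto simp: lookup_add lookup_single when_def)
  then have neq: "?s \<noteq> ?s'" by metis
  have "a \<in> {1..2 * n}" "a + n \<in> {1..2 * n}"
    using a' by auto
  then have vars: "X i \<in> vars" "X j \<in> vars" "U a \<in> vars" "U (a + n) \<in> vars"
    using i j(1) unfolding graph_vars_def by blast+
  have mon: "?s \<in> monoms vars" "?s' \<in> monoms vars"
    using vars by (simp_all add: monoms_add_iff) (simp_all add: monoms_def)
  have keys: "keys ?q = {?s, ?s'}"
    using keys_single_diff_single[OF neq] .
  have "?q \<in> forms vars 2"
    unfolding forms_def carrier_poly_ring keys mem_Collect_eq using mon by (simp add: mdeg_add)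
  moreover have "?q \<in> Ann vars (graph_form m Fs)"
  proof (rule binomial_in_AnnI)
    show "?q \<in> carrier (poly_ring vars)" "?s \<noteq> ?s'"
      using forms_in_carrier[OF \<open>?q \<in> forms vars 2\<close>] neq by blast+
    show "?s + t \<in> facets \<longleftrightarrow> ?s' + t \<in> facets" for t
      unfolding iff diff ..
  qed
  ultimately show ?thesis using that by blast
qed

text \<open>The u-variables weigh more than all x-variables, and u_a more than u_(a+n), so the
  exponent of u_a decides the comparison whatever i and j are.\<close>

lemma Max_keys_binomial:
  fixes i j :: nat
  assumes "a \<le> n" "0 < n"
  defines "s \<equiv> single (X i) 1 + single (U a) (1::nat)"
    and "s' \<equiv> single (X j) 1 + single (U (a + n)) (1::nat)"
  shows "single s 1 - single s' (1 :: 'k::comm_ring_1) \<noteq> 0"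
    and "Max (keys (single s 1 - single s' (1 :: 'k))) = s"
proof -
  have "lookup s' (U a) < lookup s (U a)"
    using assms by (auto simp: lookup_add lookup_single when_def)
  moreover have "lookup s' v = lookup s v" if "v < U a" for v
    using that by (auto simp: s_def s'_def less_U_iff lookup_add lookup_single when_def)
  ultimately have "s' < s"
    by (auto simp: less_poly_mapping.rep_eq less_fun_def)
  then have keys: "keys (single s 1 - single s' (1 :: 'k)) = {s, s'}"
    by (intro keys_single_diff_single) auto
  then show "single s 1 - single s' (1 :: 'k) \<noteq> 0" by auto
  show "Max (keys (single s 1 - single s' (1 :: 'k))) = s"
    unfolding keys using \<open>s' < s\<close> by (auto simp: max_def)
qed

text \<open>If no quadratic leading monomial divides the leading monomial t of p, then t has so
  special a shape that some cofactor isolates its coefficient in p, which would have to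
  vanish.\<close>

lemma leading_monom_dvd:
  fixes p :: "(graph_var, 'k::field_char_0) mpoly"
  assumes p: "p \<in> Ann vars (graph_form m Fs)" "p \<noteq> 0"
  shows "\<exists>q\<in>Ann vars (graph_form m Fs :: (graph_var, 'k) mpoly) \<inter> forms vars 2. \<exists>u. q \<noteq> 0 \<and>
    Max (keys p) = Max (keys q) + u"
proof (rule ccontr)
  assume contra: "\<not> ?thesis"
  define t where "t = Max (keys p)"
  have t_key: "t \<in> keys p" using p(2) unfolding t_def by (intro Max_in) auto
  have t_max: "s \<le> t" if "s \<in> keys p" for s
    using that unfolding t_def by simp
  have p_carrier: "keys p \<subseteq> monoms vars" using p(1) by (simp add: Ann_def carrier_poly_ring)
  then have t_monom: "keys t \<subseteq> vars" using t_key by (auto simp: monoms_def)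
  \<comment> \<open>Otherwise the quadratic monomial itself lies in the annihilator and divides
    t.\<close>
  have quad: "\<exists>i\<in>{1..m}. \<forall>v. lookup (single x 1 + single y 1) v \<le> lookup (fmon Fs i) v"
    if xy: "\<And>v. lookup (single x 1 + single y 1) v \<le> lookup t v" for x y
  proof (rule ccontr)
    let ?s = "single x 1 + single y (1::nat)"
    assume no_facet: "\<not> ?thesis"
    have "x \<in> keys t" "y \<in> keys t"
      using xy[of x] xy[of y] by (auto simp: in_keys_iff lookup_add)
    then have s: "?s \<in> monoms vars"
      using t_monom unfolding monoms_add_iff by (auto simp: monoms_def)
    then have "single ?s 1 \<in> Ann vars (graph_form m Fs :: (graph_var, 'k) mpoly)"
      using no_facet by (intro monom_in_AnnI) (auto simp: not_le)
    moreover have "single ?s (1 :: 'k) \<in> forms vars 2"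
      using s by (auto simp: forms_def single_in_carrier mdeg_add)
    moreover have "Max (keys p) = Max (keys (single ?s (1 :: 'k))) + (t - ?s)"
      using monom_dvdI[OF xy] by (simp add: t_def)
    ultimately show False using contra by (metis IntI single_zero inj_single[THEN injD] zero_neq_one)
  qed
  have sq: "lookup t v \<le> 1" for v
  proof (rule ccontr)
    assume "\<not> ?thesis"
    then have "lookup (single v 1 + single v 1) w \<le> lookup t w" for w
      by (auto simp: lookup_add lookup_single when_def)
    then obtain i where i: "i \<in> {1..m}" "lookup (single v 1 + single v 1) v \<le> lookup (fmon Fs i) v"
      using quad by blast
    then show False
      by (auto simp: lookup_fmon[OF finite_facet i(1)] lookup_add split: graph_var.splits if_splits)
  qed
  have quad_neq: "\<exists>i\<in>{1..m}. x \<in> keys (fmon Fs i) \<and> y \<in> keys (fmon Fs i)"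
    if xy: "x \<in> keys t" "y \<in> keys t" "x \<noteq> y" for x y
  proof -
    have "lookup (single x 1 + single y 1) w \<le> lookup t w" for w
      using xy by (auto simp: lookup_add lookup_single when_def in_keys_iff)
    then obtain i where i: "i \<in> {1..m}"
      "\<And>v. lookup (single x 1 + single y 1) v \<le> lookup (fmon Fs i) v"
      using quad by blast
    have "x \<in> keys (fmon Fs i)" "y \<in> keys (fmon Fs i)"
      using i(2)[of x] i(2)[of y] by (auto simp: in_keys_iff lookup_add)
    then show ?thesis using i(1) by blast
  qed
  define \<sigma> where "\<sigma> = {j. U j \<in> keys t}"
  have \<sigma>_sub: "\<sigma> \<subseteq> {1..2 * n}"
    using t_monom by (auto simp: \<sigma>_def graph_vars_def)
  then have fin_\<sigma>: "finite \<sigma>" using finite_subset by blast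
  have lookup_U: "lookup t (U j) = (if j \<in> \<sigma> then 1 else 0)" for j
    using sq[of "U j"] by (auto simp: \<sigma>_def in_keys_iff)
  have keys_fmon: "U j \<in> keys (fmon Fs i) \<longleftrightarrow> j \<in> Fs i" "X k \<in> keys (fmon Fs i) \<longleftrightarrow> k = i"
    if "i \<in> {1..m}" for i j k
    by (simp_all add: in_keys_iff lookup_fmon[OF finite_facet that])
  \<comment> \<open>The two variables of an edge inside \<sigma> would lie in a common facet by
    \<open>quad_neq\<close>, but facets are independent.\<close>
  have independent: "\<sigma> \<in> independent_sets {1..2 * n} (whisker n E)"
    unfolding independent_sets_def
  proof (intro CollectI conjI ballI notI \<sigma>_sub)
    fix e assume e: "e \<in> whisker n E" "e \<subseteq> \<sigma>"
    have "card e = 2"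
      using e(1) graph by (auto simp: whisker_def simple_graph_def)
    then obtain j k where jk: "e = {j, k}" "j \<noteq> k" by (auto simp: card_2_iff)
    then obtain i where i: "i \<in> {1..m}" "U j \<in> keys (fmon Fs i)" "U k \<in> keys (fmon Fs i)"
      using quad_neq[of "U j" "U k"] e(2) by (auto simp: \<sigma>_def)
    then show False
      using facet_independent[OF i(1)] e(1) jk(1) keys_fmon(1)[OF i(1)]
      by (auto simp: independent_sets_def)
  qed
  \<comment> \<open>If r completes t, and no other term of p, to a facet monomial, then \<phi> of p
    times r is the coefficient of t in p, which is nonzero.\<close>
  have test: False if r: "r \<in> monoms vars" "t + r \<in> facets"
    "\<And>s. s \<in> keys p \<Longrightarrow> s + r \<in> facets \<Longrightarrow> s = t" for r
  proof -
    have "0 = (\<Sum>s\<in>keys p. if s + r \<in> facets then lookup p s else 0)"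
      using p(1) r(1) unfolding Ann_form_iff by simp
    also have "\<dots> = (\<Sum>s\<in>keys p. if s = t then lookup p s else 0)"
    proof (rule sum.cong)
      fix s assume "s \<in> keys p"
      then have "s + r \<in> facets \<longleftrightarrow> s = t" using r(2,3) by metis
      then show "(if s + r \<in> facets then lookup p s else 0) = (if s = t then lookup p s else 0)"
        by (simp only:)
    qed simp
    also have "\<dots> = lookup p t" using t_key by simp
    finally show False using t_key by (simp add: in_keys_iff)
  qed
  show False
  proof (cases "\<exists>i. X i \<in> keys t")
    case False
    have t: "t = umon \<sigma>"
    proof (rule poly_mapping_eqI)
      show "lookup t v = lookup (umon \<sigma>) v" for v
        using False by (cases v) (auto simp: lookup_umon[OF fin_\<sigma>] lookup_U in_keys_iff)
    qed
    obtain i where i: "i \<in> {1..m}" "\<sigma> \<subseteq> Fs i"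
      using independent by (rule face_subset_facet)
    have iff: "s + (single (X i) 1 + umon (Fs i - \<sigma>)) \<in> facets \<longleftrightarrow> s = t" for s
      unfolding t using umon_add_eq_fmon_iff[OF finite_facet i] .
    then have "t + (single (X i) 1 + umon (Fs i - \<sigma>)) \<in> facets" by (simp only:)
    moreover from this have "single (X i) 1 + umon (Fs i - \<sigma>) \<in> monoms vars"
      using facet_in_monoms monoms_add_iff by (metis imageE)
    ultimately show False
      using test[of "single (X i) 1 + umon (Fs i - \<sigma>)"] iff by blast
  next
    case True
    then obtain i where Xi: "X i \<in> keys t" by blast
    then have i: "i \<in> {1..m}" using t_monom by (auto simp: graph_vars_def)
    \<comment> \<open>Each facet monomial contains a single x-variable.\<close>
    have X_unique: "X k \<notin> keys t" if "k \<noteq> i" for k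
      using quad_neq[OF Xi, of "X k"] that keys_fmon(2) by auto
    have \<sigma>_facet: "\<sigma> \<subseteq> Fs i"
      using quad_neq[OF Xi] keys_fmon by (fastforce simp: \<sigma>_def)
    \<comment> \<open>For a at most n the exchange binomial would have a leading monomial dividing
      t.\<close>
    have \<sigma>_gt: "n < a" if a: "a \<in> \<sigma>" for a
    proof (rule ccontr)
      assume "\<not> n < a"
      then have "a \<le> n" by simp
      let ?s = "single (X i) 1 + single (U a) (1::nat)"
      obtain j where j: "single ?s 1 - single (single (X j) 1 + single (U (a + n)) 1) 1
        \<in> Ann vars (graph_form m Fs :: (graph_var, 'k) mpoly) \<inter> forms vars 2" (is "?q \<in> _")
        using binomial_in_Ann[OF i subsetD[OF \<sigma>_facet a] \<open>a \<le> n\<close>] by blast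
      have "0 < n" using a \<sigma>_sub by auto
      then have q: "?q \<noteq> 0" "Max (keys ?q) = ?s"
        using Max_keys_binomial[OF \<open>a \<le> n\<close>] by blast+
      have "lookup ?s v \<le> lookup t v" for v
        using Xi a by (auto simp: lookup_add lookup_single when_def in_keys_iff \<sigma>_def)
      then have "Max (keys p) = Max (keys ?q) + (t - ?s)"
        unfolding q(2) t_def[symmetric] by (rule monom_dvdI)
      then show False using contra j q(1) by blast
    qed
    have Xi1: "lookup t (X i) = 1" using sq[of "X i"] Xi by (simp add: in_keys_iff)
    have t: "t = single (X i) 1 + umon \<sigma>"
    proof (rule poly_mapping_eqI)
      show "lookup t v = lookup (single (X i) 1 + umon \<sigma>) v" for v
        using X_unique Xi1
        by (cases v) (auto simp: lookup_add lookup_single when_def lookup_umon[OF fin_\<sigma>] lookup_U in_keys_iff)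
    qed
    let ?r = "umon (Fs i - \<sigma>)"
    have tr: "t + ?r = fmon Fs i"
      unfolding t using X_umon_add_eq_fmon_iff[OF finite_facet i \<sigma>_facet i] by simp
    show False
    proof (rule test[of ?r])
      show "?r \<in> monoms vars" "t + ?r \<in> facets"
        using facet_in_monoms[OF i] monoms_add_iff[of t ?r] i unfolding tr by auto
      fix s assume s: "s \<in> keys p" "s + ?r \<in> facets"
      then obtain j where j: "j \<in> {1..m}" "s + ?r = fmon Fs j" by blast
      have lookup_s: "lookup s v + lookup ?r v = lookup (fmon Fs j) v" for v
        using j(2) by (metis lookup_add)
      \<comment> \<open>The vertices of H in F_i avoid \<sigma>, so they occur in \<open>?r\<close>
        and belong to F_j. A different j thus has a further vertex a of H, and u_a divides
        s.\<close>
      have "j = i"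
      proof (rule ccontr)
        assume "j \<noteq> i"
        have "Fs i \<inter> {1..n} \<subseteq> Fs j \<inter> {1..n}"
        proof
          fix a assume a: "a \<in> Fs i \<inter> {1..n}"
          then have "a \<notin> \<sigma>" using \<sigma>_gt by fastforce
          then have "lookup ?r (U a) = 1"
            using a by (simp add: lookup_umon bspec[OF finite_facet i])
          then have "lookup (fmon Fs j) (U a) \<noteq> 0"
            using lookup_s[of "U a"] by simp
          then show "a \<in> Fs j \<inter> {1..n}"
            using a by (simp add: lookup_fmon[OF finite_facet j(1)] split: if_splits)
        qed
        then obtain a where a: "a \<in> Fs j" "a \<notin> Fs i" "a \<in> {1..n}"
          using facet_eqI[OF j(1) i] \<open>j \<noteq> i\<close> by blast
        then have "lookup s (U a) \<noteq> 0"
          using lookup_s[of "U a"]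
          by (simp add: lookup_umon bspec[OF finite_facet i] lookup_fmon[OF finite_facet j(1)])
        \<comment> \<open>The heaviest variable of s is u_b with b at most n, while t has no
          u-variable with index up to n; so s would exceed t.\<close>
        define b where "b = (LEAST b. lookup s (U b) \<noteq> 0)"
        have b: "lookup s (U b) \<noteq> 0" "b \<le> a"
          unfolding b_def using \<open>lookup s (U a) \<noteq> 0\<close> by (auto intro: LeastI Least_le)
        have t0: "lookup t (U c) = 0" if "c \<le> a" for c
          using \<sigma>_gt[of c] that a(3) by (auto simp: lookup_U)
        have "lookup t (U b) < lookup s (U b)"
          using b t0 by simp
        moreover have "lookup t v = lookup s v" if "v < U b" for v
          using that t0 b not_less_Least[of _ "\<lambda>b. lookup s (U b) \<noteq> 0"]
          unfolding b_def[symmetric] less_U_iff by fastforce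
        ultimately have "t < s"
          by (auto simp: less_poly_mapping.rep_eq less_fun_def)
        then show False using t_max[OF s(1)] by simp
      qed
      then show "s = t" using j(2) tr by (metis add_right_cancel)
    qed
  qed
qed

end


section \<open>Derivations and linear forms\<close>

lemma partial_deriv_add: "partial_deriv v (p + q) = partial_deriv v p + partial_deriv v q"
  by (rule poly_mapping_eqI) (simp add: lookup_partial_deriv lookup_add algebra_simps)

lemma partial_deriv_zero [simp]: "partial_deriv v 0 = 0"
  by (simp add: partial_deriv_def)

lemma partial_deriv_sum: "partial_deriv v (\<Sum>i\<in>A. p i) = (\<Sum>i\<in>A. partial_deriv v (p i))"
  by (induction A rule: infinite_finite_induct) (auto simp: partial_deriv_add)

lemma partial_deriv_Const_mult: "partial_deriv v (Const a * p) = Const a * partial_deriv v p"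
  by (rule poly_mapping_eqI) (simp add: lookup_partial_deriv mult.left_commute)

lemma partial_deriv_single:
  "partial_deriv v (single t a) = single (t - single v 1) (of_nat (lookup t v) * a)"
  by (cases "a = 0") (simp_all add: partial_deriv_def)

lemma partial_deriv_Var: "partial_deriv v (Var w) = (if v = w then 1 else 0)"
  by (auto simp: Var_def partial_deriv_single lookup_single when_def)

lemma partial_deriv_mult_single:
  "partial_deriv v (single s a * single t b) =
    partial_deriv v (single s a) * single t b + single s a * partial_deriv v (single t b)"
proof -
  \<comment> \<open>Subtraction of exponents is truncated, so it moves past an addition only if v
    occurs in r; if it does not, the coefficient is zero.\<close>
  have minus: "r - single v 1 + r' = r + r' - single v 1" if "lookup r v \<noteq> 0" for r r' :: "'a monom"
    using that
    by (intro poly_mapping_eqI) (auto simp: lookup_add lookup_minus lookup_single when_def)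
  have left: "partial_deriv v (single s a) * single t b =
      single (s + t - single v 1) (of_nat (lookup s v) * a * b)"
    by (cases "lookup s v = 0") (simp_all add: partial_deriv_single mult_single minus del: One_nat_def)
  have right: "single s a * partial_deriv v (single t b) =
      single (s + t - single v 1) (of_nat (lookup t v) * a * b)"
    using minus[of t s]
    by (cases "lookup t v = 0")
      (simp_all add: partial_deriv_single mult_single add.commute mult_ac del: One_nat_def)
  show ?thesis
    unfolding left right
    by (simp add: mult_single partial_deriv_single lookup_add single_add[symmetric] algebra_simps)
qed

lemma partial_deriv_mult:
  "partial_deriv v (p * q) = partial_deriv v p * q + p * partial_deriv v q"
proof -
  have "partial_deriv v ((\<Sum>s\<in>keys p. single s (lookup p s)) * (\<Sum>t\<in>keys q. single t (lookup q t))) =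
    partial_deriv v (\<Sum>s\<in>keys p. single s (lookup p s)) * (\<Sum>t\<in>keys q. single t (lookup q t)) +
    (\<Sum>s\<in>keys p. single s (lookup p s)) * partial_deriv v (\<Sum>t\<in>keys q. single t (lookup q t))"
    unfolding sum_product partial_deriv_sum partial_deriv_mult_single sum.distrib ..
  then show ?thesis unfolding poly_eq_sum_single .
qed

text \<open>The derivation D by which the linear form with coefficients \<open>c\<close>
  acts.\<close>

definition dir_deriv :: "'v set \<Rightarrow> ('v \<Rightarrow> 'k) \<Rightarrow> ('v, 'k::comm_ring_1) mpoly \<Rightarrow> ('v, 'k) mpoly" where
  "dir_deriv V c w = (\<Sum>v\<in>V. Const (c v) * partial_deriv v w)"

lemma dir_deriv_mult: "dir_deriv V c (p * q) = dir_deriv V c p * q + p * dir_deriv V c q"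
  unfolding dir_deriv_def partial_deriv_mult distrib_left sum.distrib sum_distrib_left sum_distrib_right
  by (simp add: mult_ac)

lemma dir_deriv_one [simp]: "dir_deriv V c (1 :: ('v, 'k::comm_ring_1) mpoly) = 0"
proof -
  have "partial_deriv v (1 :: ('v, 'k) mpoly) = 0" for v
    unfolding single_one[symmetric] partial_deriv_single by simp
  then show ?thesis by (simp add: dir_deriv_def)
qed

lemma dir_deriv_linear:
  assumes "finite V" "x \<in> V" "y \<in> V"
  shows "dir_deriv V c (Const a * Var x + Const b * Var y) = Const (c x * a + c y * b)"
proof -
  have "dir_deriv V c (Const a * Var x + Const b * Var y) =
    (\<Sum>v\<in>V. if v = x then Const (c v) * Const a else 0) + (\<Sum>v\<in>V. if v = y then Const (c v) * Const b else 0)"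
    unfolding dir_deriv_def partial_deriv_add partial_deriv_Const_mult partial_deriv_Var
    by (auto simp: distrib_left sum.distrib intro!: arg_cong2[where f = "(+)"] sum.cong)
  then show ?thesis
    using assms by (simp add: Const_def mult_single single_add)
qed

text \<open>Each pair carries a nonzero linear form killed by the derivation. Their product is
  nonzero in a domain, is killed by the Leibniz rule, and expands into monomials that choose one
  variable from each pair.\<close>

lemma ex_product_in_kernel:
  fixes V :: "'v::linorder set" and c :: "'v \<Rightarrow> 'k::field" and d :: nat
  assumes "finite V" "\<And>i. i < d \<Longrightarrow> P i \<in> V \<and> Q i \<in> V \<and> P i \<noteq> Q i"
  shows "\<exists>w. w \<noteq> 0 \<and> dir_deriv V c w = 0 \<and>
    (\<forall>t\<in>keys w. \<exists>f. (\<forall>i<d. f i \<in> {P i, Q i}) \<and> t = (\<Sum>i<d. single (f i) 1))"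
  using assms(2)
proof (induction d)
  case 0
  then show ?case by (intro exI[of _ 1]) simp
next
  case (Suc d)
  obtain w where w: "w \<noteq> 0" "dir_deriv V c w = 0"
    "\<And>t. t \<in> keys w \<Longrightarrow> \<exists>f. (\<forall>i<d. f i \<in> {P i, Q i}) \<and> t = (\<Sum>i<d. single (f i) 1)"
    using Suc.IH Suc.prems by (metis less_SucI)
  let ?x = "P d" and ?y = "Q d"
  have xy: "?x \<in> V" "?y \<in> V" "?x \<noteq> ?y" using Suc.prems by auto
  \<comment> \<open>One linear equation in two unknowns: (c_y, - c_x) solves it, and (1, 0) serves
    if both coefficients vanish.\<close>
  obtain a b where ab: "a \<noteq> 0 \<or> b \<noteq> 0" "c ?x * a + c ?y * b = 0"
  proof (cases "c ?x = 0 \<and> c ?y = 0")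
    case True
    then show ?thesis using that[of 1 0] by simp
  next
    case False
    then show ?thesis using that[of "c ?y" "- c ?x"] by (auto simp: mult.commute)
  qed
  define l where "l = Const a * Var ?x + Const b * Var ?y"
  have l: "l = single (single ?x 1) a + single (single ?y 1) b"
    by (simp add: l_def Const_def Var_def mult_single)
  have "single ?x (1::nat) \<noteq> single ?y 1"
    using xy(3) by (metis keys_single insert_absorb insert_not_empty singletonD singletonI zero_neq_one)
  then have "lookup l (single ?x 1) = a" "lookup l (single ?y 1) = b"
    by (simp_all add: l lookup_add lookup_single when_def)
  then have "l \<noteq> 0" using ab(1) by auto
  show ?case
  proof (intro exI[of _ "w * l"] conjI ballI)
    show "w * l \<noteq> 0" using w(1) \<open>l \<noteq> 0\<close> by simp
    have "dir_deriv V c l = 0"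
      unfolding l_def dir_deriv_linear[OF assms(1) xy(1,2)] ab(2) by (simp add: Const_def)
    then show "dir_deriv V c (w * l) = 0"
      by (simp add: dir_deriv_mult w(2))
    fix t assume "t \<in> keys (w * l)"
    then obtain s r where sr: "s \<in> keys w" "r \<in> keys l" "t = s + r"
      using keys_mult[of w l] by blast
    have "keys l \<subseteq> keys (single (single ?x 1) a) \<union> keys (single (single ?y 1) b)"
      unfolding l by (rule Poly_Mapping.keys_add)
    also have "\<dots> \<subseteq> {single ?x 1, single ?y 1}" by simp
    finally have "r \<in> {single ?x 1, single ?y 1}" using sr(2) by blast
    then obtain z where s: "s \<in> keys w" "t = s + single z 1" "z \<in> {?x, ?y}"
      using sr by auto
    obtain f where f: "\<forall>i<d. f i \<in> {P i, Q i}" "s = (\<Sum>i<d. single (f i) 1)"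
      using w(3)[OF s(1)] by blast
    have "(\<forall>i<Suc d. (f(d := z)) i \<in> {P i, Q i}) \<and> t = (\<Sum>i<Suc d. single ((f(d := z)) i) 1)"
      using f s by (auto simp: less_Suc_eq)
    then show "\<exists>f. (\<forall>i<Suc d. f i \<in> {P i, Q i}) \<and> t = (\<Sum>i<Suc d. single (f i) 1)" by blast
  qed
qed

lemma linear_form_eq:
  assumes "finite V" "p \<in> forms V 1"
  shows "p = (\<Sum>v\<in>V. Const (lookup p (single v 1)) * single (single v 1) 1)"
proof (rule poly_mapping_eqI)
  fix t
  have inj: "single v (1::nat) = single w 1 \<longleftrightarrow> v = w" for v w :: 'a
    by (metis keys_single singleton_iff zero_neq_one)
  have rhs: "lookup (\<Sum>v\<in>V. Const (lookup p (single v 1)) * single (single v 1) 1) t =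
      (\<Sum>v\<in>V. if single v 1 = t then lookup p t else 0)"
    unfolding lookup_sum by (intro sum.cong) (auto simp: lookup_single when_def)
  show "lookup p t = lookup (\<Sum>v\<in>V. Const (lookup p (single v 1)) * single (single v 1) 1) t"
  proof (cases "\<exists>w\<in>V. t = single w 1")
    case True
    then obtain w where "w \<in> V" "t = single w 1" by blast
    then show ?thesis unfolding rhs using assms(1) by (simp add: inj del: One_nat_def)
  next
    case False
    have "t \<notin> keys p"
    proof
      assume "t \<in> keys p"
      then have t: "keys t \<subseteq> V" "mdeg t = 1"
        using assms(2) by (auto simp: forms_def carrier_poly_ring monoms_def)
      then obtain w where w: "w \<in> keys t" "lookup t w = 1" "\<And>v. v \<in> keys t \<Longrightarrow> w \<noteq> v \<Longrightarrow> lookup t v = 0"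
        using t(2) unfolding mdeg_def sum_eq_1_iff[OF finite_keys] by metis
      have "lookup t v = lookup (single w 1) v" for v
        using w by (cases "v = w") (metis in_keys_iff lookup_single_eq lookup_single_not_eq)+
      then have "t = single w 1" by (intro poly_mapping_eqI)
      then show False using False t(1) w(1) by blast
    qed
    then show ?thesis
      unfolding rhs using False by (simp add: in_keys_iff cong: if_cong)
  qed
qed

section \<open>Transversal faces and the failure of the weak Lefschetz property\<close>

context whiskered_graph
begin

text \<open>Distinct pairs involve disjoint sets of vertices of H or their whiskers, so no a and a +
  n are chosen together, and chosen vertices of H lie in the independent set S. The first three
  pairs use up one index each, the others two.\<close>

lemma ex_transversal_pairs:
  assumes S: "S \<in> independent_sets {1..n} E" "card S = 3" and d: "2 * d \<le> n + 3"
  obtains P Q where "\<forall>i<d. P i \<in> {1..2 * n} \<and> Q i \<in> {1..2 * n} \<and> P i \<noteq> Q i"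
    "\<forall>f. (\<forall>i<d. f i \<in> {P i, Q i}) \<longrightarrow> inj_on f {..<d} \<and>
      f ` {..<d} \<in> independent_sets {1..2 * n} (whisker n E)"
proof -
  have S_sub: "S \<subseteq> {1..n}" using S(1) by (simp add: independent_sets_def)
  then have "finite S" using finite_subset by blast
  obtain xs where xs: "set xs = S" "distinct xs"
    using finite_distinct_list[OF \<open>finite S\<close>] by blast
  obtain ys where ys: "set ys = {1..n} - S" "distinct ys"
    using finite_distinct_list[of "{1..n} - S"] by blast
  have len: "length xs = 3" "length (xs @ ys) = n"
    using distinct_card[OF xs(2)] distinct_card[of "xs @ ys"] xs ys S(2) S_sub
    by (auto simp: Un_absorb1)
  then have "3 \<le> n" by simp
  define e where "e i = (xs @ ys) ! i" for i
  have e_range: "1 \<le> e i" "e i \<le> n" if "i < n" for i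
    using nth_mem[of i "xs @ ys"] that len S_sub xs ys unfolding e_def by auto
  have e_inj: "i = j" if "e i = e j" "i < n" "j < n" for i j
    using nth_eq_iff_index_eq[of "xs @ ys" i j] that len xs ys unfolding e_def by auto
  have e_S: "e i \<in> S" if "i < 3" for i
    using that len(1) xs nth_mem[of i xs] by (simp add: e_def nth_append)
  \<comment> \<open>The vertices of S come first in \<open>e\<close>. For i >= 3 the pairs use
    positions 3, 4, then 5, 6, and so on; the last position 2 d - 4 is below n because 2 d is at
    most n + 3.\<close>
  define P where "P i = (if i < 3 then e i else e (2 * i - 3) + n)" for i
  define Q where "Q i = (if i < 3 then e i + n else e (2 * i - 2) + n)" for i
  show ?thesis
  proof (rule that; intro allI impI)
    fix i assume i: "i < d"
    show "P i \<in> {1..2 * n} \<and> Q i \<in> {1..2 * n} \<and> P i \<noteq> Q i"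
    proof (cases "i < 3")
      case True
      then show ?thesis using e_range[of i] \<open>3 \<le> n\<close> by (simp add: P_def Q_def)
    next
      case False
      then have k: "2 * i - 3 < n" "2 * i - 2 < n" "2 * i - 3 \<noteq> 2 * i - 2"
        using i d by auto
      then have "e (2 * i - 3) \<noteq> e (2 * i - 2)" using e_inj by blast
      then show ?thesis
        using False e_range[OF k(1)] e_range[OF k(2)] by (simp add: P_def Q_def)
    qed
  next
    fix f assume f: "\<forall>i<d. f i \<in> {P i, Q i}"
    \<comment> \<open>the index of the pair that contains the vertex \<open>e k\<close> or \<open>e k + n\<close>\<close>
    define block where "block k = (if k < 3 then k else (k + 3) div 2)" for k :: nat
    have "\<exists>k<n. block k = i \<and> (f i = e k \<and> k < 3 \<or> f i = e k + n)" if i: "i < d" for i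
    proof (cases "i < 3")
      case True
      then show ?thesis
        using f i \<open>3 \<le> n\<close> by (intro exI[of _ i]) (auto simp: P_def Q_def block_def)
    next
      case False
      then have k: "2 * i - 3 < n" "2 * i - 2 < n" "block (2 * i - 3) = i" "block (2 * i - 2) = i"
        using i d by (auto simp: block_def)
      moreover have "f i = e (2 * i - 3) + n \<or> f i = e (2 * i - 2) + n"
        using f i False by (auto simp: P_def Q_def)
      ultimately show ?thesis by blast
    qed
    then obtain k where k: "\<And>i. i < d \<Longrightarrow> k i < n" "\<And>i. i < d \<Longrightarrow> block (k i) = i"
      "\<And>i. i < d \<Longrightarrow> f i = e (k i) \<and> k i < 3 \<or> f i = e (k i) + n"
      by metis
    have e_k: "1 \<le> e (k i)" "e (k i) \<le> n" if "i < d" for i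
      using e_range[OF k(1)[OF that]] by auto
    \<comment> \<open>\<open>block\<close> recovers i from \<open>k i\<close>, so different pairs
      use different vertices.\<close>
    have same: "i = j" if "i < d" "j < d" "e (k i) = e (k j)" for i j
      using e_inj[OF that(3)] k(1,2) that(1,2) by metis
    have inj: "inj_on f {..<d}"
    proof (rule inj_onI)
      fix i j assume ij: "i \<in> {..<d}" "j \<in> {..<d}" "f i = f j"
      then have "e (k i) = e (k j)"
        using k(3)[of i] k(3)[of j] e_k[of i] e_k[of j] by auto
      then show "i = j" using ij same by simp
    qed
    moreover have "f ` {..<d} \<in> independent_sets {1..2 * n} (whisker n E)"
      unfolding independent_whisker_iff[OF graph]
    proof (intro conjI ballI impI)
      show "f ` {..<d} \<subseteq> {1..2 * n}"
      proof
        fix j assume "j \<in> f ` {..<d}"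
        then obtain i where "i < d" "j = f i" by blast
        then show "j \<in> {1..2 * n}" using k(3)[of i] e_k[of i] by auto
      qed
      have "f ` {..<d} \<inter> {1..n} \<subseteq> S"
      proof
        fix j assume "j \<in> f ` {..<d} \<inter> {1..n}"
        then obtain i where "i < d" "j = f i" "f i \<le> n" by auto
        then show "j \<in> S" using k(3)[of i] e_k[of i] e_S by auto
      qed
      then show "f ` {..<d} \<inter> {1..n} \<in> independent_sets {1..n} E"
        using independent_set_subset[OF S(1)] by blast
      fix a assume a: "a \<in> {1..n}" "a \<in> f ` {..<d}"
      show "a + n \<notin> f ` {..<d}"
      proof
        assume "a + n \<in> f ` {..<d}"
        then obtain j where j: "j < d" "a + n = f j" by blast
        obtain i where i: "i < d" "a = f i" using a(2) by blast
        have "e (k i) = a" "e (k j) = a"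
          using k(3)[OF i(1)] k(3)[OF j(1)] e_k[OF i(1)] e_k[OF j(1)] i(2) j(2) a(1) by auto
        then have "i = j" using same i(1) j(1) by metis
        then show False using i(2) j(2) a(1) by simp
      qed
    qed
    ultimately show "inj_on f {..<d} \<and> f ` {..<d} \<in> independent_sets {1..2 * n} (whisker n E)" ..
  qed
qed

text \<open>Multiplication by p is dual to D: with z chosen so that its pairings are the
  coefficients of w, the pairing of p z with t is the coefficient of t in D w, which is
  zero.\<close>

lemma ex_form_killed:
  fixes p :: "(graph_var, 'k::field_char_0) mpoly"
  defines "F \<equiv> graph_form m Fs :: (graph_var, 'k) mpoly"
  assumes S: "S \<in> independent_sets {1..n} E" "card S = 3"
    and d: "2 * d \<le> n + 3" and p: "p \<in> forms vars 1"
  obtains z where "z \<in> forms vars (n + 1 - d)" "z \<notin> Ann vars F" "p * z \<in> Ann vars F"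
proof -
  have fin_vars: "finite vars" by (simp add: graph_vars_def)
  obtain P Q where PQ: "\<forall>i<d. P i \<in> {1..2 * n} \<and> Q i \<in> {1..2 * n} \<and> P i \<noteq> Q i"
    and ind: "\<forall>f. (\<forall>i<d. f i \<in> {P i, Q i}) \<longrightarrow> inj_on f {..<d} \<and>
      f ` {..<d} \<in> independent_sets {1..2 * n} (whisker n E)"
    using S d by (rule ex_transversal_pairs)
  define c where "c v = lookup p (single v 1)" for v
  have "U (P i) \<in> vars \<and> U (Q i) \<in> vars \<and> U (P i) \<noteq> U (Q i)" if "i < d" for i
    using PQ that unfolding graph_vars_def by blast
  then obtain w where w: "w \<noteq> 0" "dir_deriv vars c w = 0"
    and keys_w: "\<And>t. t \<in> keys w \<Longrightarrow>
      \<exists>f. (\<forall>i<d. f i \<in> {U (P i), U (Q i)}) \<and> t = (\<Sum>i<d. single (f i) 1)"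
    using ex_product_in_kernel[OF fin_vars, of d "\<lambda>i. U (P i)" "\<lambda>i. U (Q i)" c] by blast
  have face: "\<exists>A. A \<in> independent_sets {1..2 * n} (whisker n E) \<and> card A = d \<and> t = umon A"
    if t: "t \<in> keys w" for t
  proof -
    obtain f where f: "\<And>i. i < d \<Longrightarrow> f i \<in> {U (P i), U (Q i)}" "t = (\<Sum>i<d. single (f i) 1)"
      using keys_w[OF t] by blast
    define g where "g i = (if f i = U (P i) then P i else Q i)" for i
    have g: "f i = U (g i)" "g i \<in> {P i, Q i}" if "i < d" for i
      using f(1)[OF that] by (auto simp: g_def)
    have inj: "inj_on g {..<d}" and indep: "g ` {..<d} \<in> independent_sets {1..2 * n} (whisker n E)"
      using ind g(2) by blast+
    have "t = umon (g ` {..<d})"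
      unfolding f(2) umon_def sum.reindex[OF inj] using g(1) by (intro sum.cong) simp_all
    moreover have "card (g ` {..<d}) = d"
      using card_image[OF inj] by simp
    ultimately show ?thesis using indep by blast
  qed
  have squarefree: "lookup t v \<le> 1" if t: "t \<in> keys w" for t v
  proof -
    obtain A where A: "A \<subseteq> {1..2 * n}" "t = umon A"
      using face[OF t] unfolding independent_sets_def by blast
    then show ?thesis
      using finite_subset[OF A(1)] by (simp add: lookup_umon split: graph_var.splits)
  qed
  \<comment> \<open>For t = u_A with A inside F_i, u is x_i u_(F_i - A), whose only cofactor in the
    form is t.\<close>
  have "\<forall>t\<in>keys w. \<exists>u. t \<in> monoms vars \<and> u \<in> monoms vars \<and> mdeg u = n + 1 - d \<and>
      (\<forall>s. u + s \<in> facets \<longleftrightarrow> s = t)"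
  proof
    fix t assume "t \<in> keys w"
    then obtain A where A: "A \<in> independent_sets {1..2 * n} (whisker n E)" "card A = d" "t = umon A"
      using face by blast
    obtain i where i: "i \<in> {1..m}" "A \<subseteq> Fs i"
      using A(1) by (rule face_subset_facet)
    let ?u = "single (X i) 1 + umon (Fs i - A)"
    have iff: "?u + s \<in> facets \<longleftrightarrow> s = t" for s
      using umon_add_eq_fmon_iff[OF finite_facet i] by (simp only: A(3) add.commute)
    then have "?u + t \<in> facets" by (simp only:)
    then have "?u + t \<in> monoms vars" using facet_in_monoms by (metis imageE)
    then have "?u \<in> monoms vars" "t \<in> monoms vars"
      using monoms_add_iff by blast+
    moreover have "mdeg ?u = n + 1 - d"
    proof -
      have "finite A" using i(2) bspec[OF finite_facet i(1)] by (rule finite_subset)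
      then have "card (Fs i - A) = n - d" "d \<le> n"
        using card_facet[OF i(1)] A(2) i(2) card_mono[OF bspec[OF finite_facet i(1)] i(2)]
        by (simp_all add: card_Diff_subset)
      moreover have "mdeg ?u = 1 + card (Fs i - A)"
        unfolding umon_def mdeg_add mdeg_sum mdeg_single by simp
      ultimately show ?thesis by linarith
    qed
    ultimately show "\<exists>u. t \<in> monoms vars \<and> u \<in> monoms vars \<and> mdeg u = n + 1 - d \<and>
      (\<forall>s. u + s \<in> facets \<longleftrightarrow> s = t)"
      using iff by blast
  qed
  then obtain \<zeta> where \<zeta>: "\<And>t. t \<in> keys w \<Longrightarrow> t \<in> monoms vars \<and> \<zeta> t \<in> monoms vars \<and>
      mdeg (\<zeta> t) = n + 1 - d \<and> (\<forall>s. \<zeta> t + s \<in> facets \<longleftrightarrow> s = t)"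
    by metis
  \<comment> \<open>\<open>\<zeta> t\<close> is the complement of \<open>t\<close> in a facet containing it; hence \<open>z \<circ> F = w\<close>\<close>
  define z where "z = (\<Sum>t\<in>keys w. single (\<zeta> t) (lookup w t))"
  have pairing_z: "pairing F (z * single s 1) = lookup w s" for s
  proof -
    have "pairing F (z * single s 1) = (\<Sum>t\<in>keys w. if \<zeta> t + s \<in> facets then lookup w t else 0)"
      unfolding z_def F_def sum_distrib_right pairing_sum mult_single
        pairing_graph_form_single[OF finite_facet] mult_1_right ..
    also have "\<dots> = (\<Sum>t\<in>keys w. if t = s then lookup w t else 0)"
    proof (rule sum.cong)
      fix t assume "t \<in> keys w"
      then have "\<zeta> t + s \<in> facets \<longleftrightarrow> t = s" using \<zeta> by metis
      then show "(if \<zeta> t + s \<in> facets then lookup w t else 0) = (if t = s then lookup w t else 0)"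
        by (simp only:)
    qed simp
    also have "\<dots> = lookup w s" by (simp add: in_keys_iff)
    finally show ?thesis .
  qed
  have "keys z \<subseteq> \<zeta> ` keys w"
    unfolding z_def by (rule subset_trans[OF keys_sum]) auto
  then have z_form: "z \<in> forms vars (n + 1 - d)"
    using \<zeta> unfolding forms_def carrier_poly_ring by blast
  have F: "F \<in> forms vars (n + 1)" unfolding F_def by (rule form_in_forms)
  show ?thesis
  proof (rule that[OF z_form])
    obtain t where "t \<in> keys w" using w(1) by (metis keys_eq_empty equals0I)
    then show "z \<notin> Ann vars F"
      using \<zeta> pairing_z[of t] unfolding Ann_iff[OF F] by (metis in_keys_iff)
    show "p * z \<in> Ann vars F"
      unfolding Ann_iff[OF F]
    proof (intro conjI ballI)
      show "p * z \<in> carrier (poly_ring vars)"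
        using poly_ring_closed(4) forms_in_carrier p z_form by blast
      fix t :: "graph_var monom"
      have "p * z * single t 1 = (\<Sum>v\<in>vars. Const (c v) * (z * single (single v 1 + t) 1))"
      proof -
        have *: "single (s + s') (1 :: 'k) = single s 1 * single s' 1" for s s' :: "graph_var monom"
          by (simp add: mult_single)
        have "(\<Sum>v\<in>vars. Const (c v) * single (single v 1) 1) * z * single t 1 =
            (\<Sum>v\<in>vars. Const (c v) * (z * single (single v 1 + t) 1))"
          unfolding sum_distrib_right * by (simp only: mult_ac)
        then show ?thesis
          unfolding c_def linear_form_eq[OF fin_vars p, symmetric] .
      qed
      then have "pairing F (p * z * single t 1) = (\<Sum>v\<in>vars. c v * lookup w (single v 1 + t))"
        by (simp only: pairing_sum pairing_Const_mult pairing_z)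
      also have "\<dots> = lookup (dir_deriv vars c w) t"
        unfolding dir_deriv_def lookup_sum lookup_Const_mult lookup_partial_deriv
      proof (intro sum.cong refl arg_cong2[where f = "(*)"])
        fix v
        \<comment> \<open>Squarefreeness of w turns the factor produced by the derivative into 1
          wherever the coefficient is nonzero.\<close>
        show "lookup w (single v 1 + t) = of_nat (lookup t v + 1) * lookup w (t + single v 1)"
        proof (cases "t + single v 1 \<in> keys w")
          case True
          then have "lookup t v = 0" using squarefree[OF True, of v] by (simp add: lookup_add)
          then show ?thesis by (simp add: add.commute)
        qed (simp add: in_keys_iff add.commute)
      qed
      finally show "pairing F (p * z * single t 1) = 0" by (simp add: w(2))
    qed
  qed
qed

text \<open>A killed class in degree k refutes injectivity. A killed class in degree n - k, paired
  with degree k + 1, vanishes on the image of L and so refutes surjectivity.\<close>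

lemma not_weak_lefschetz:
  assumes S: "S \<in> independent_sets {1..n} E" "card S = 3"
  shows "\<not> weak_lefschetz vars (Ann vars (graph_form m Fs :: (graph_var, 'k::field_char_0) mpoly))"
proof
  define F where "F = (graph_form m Fs :: (graph_var, 'k) mpoly)"
  let ?R = "poly_ring vars :: (graph_var, 'k) mpoly ring" and ?I = "Ann vars F"
  let ?Q = "?R Quot ?I"
  have F: "F \<in> forms vars (n + 1)" unfolding F_def by (rule form_in_forms)
  note I = ideal_Ann[OF F]
  assume "weak_lefschetz vars (Ann vars (graph_form m Fs :: (graph_var, 'k) mpoly))"
  then obtain L where L: "L \<in> graded_piece vars ?I 1"
    "\<And>i. inj_on (\<lambda>a. L \<otimes>\<^bsub>?Q\<^esub> a) (graded_piece vars ?I i) \<or>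
        (\<lambda>a. L \<otimes>\<^bsub>?Q\<^esub> a) ` graded_piece vars ?I i = graded_piece vars ?I (Suc i)"
    unfolding weak_lefschetz_def F_def[symmetric] by blast
  obtain p where p: "p \<in> forms vars 1" "L = quot_class vars ?I p"
    using L(1) by (auto simp: graded_piece_def)
  note p_carrier = forms_in_carrier[OF p(1)]
  \<comment> \<open>The middle degree: both d = n + 1 - k and d = k + 1 then satisfy the bound 2 d
    <= n + 3.\<close>
  define k where "k = n div 2"
  have "\<not> inj_on (\<lambda>a. L \<otimes>\<^bsub>?Q\<^esub> a) (graded_piece vars ?I k)"
  proof
    assume inj: "inj_on (\<lambda>a. L \<otimes>\<^bsub>?Q\<^esub> a) (graded_piece vars ?I k)"
    have "2 * (n + 1 - k) \<le> n + 3" "n + 1 - (n + 1 - k) = k" unfolding k_def by auto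
    then obtain z where z: "z \<in> forms vars k" "z \<notin> ?I" "p * z \<in> ?I"
      using ex_form_killed[OF S _ p(1), of "n + 1 - k"] unfolding F_def by metis
    have zero: "(0 :: (graph_var, 'k) mpoly) \<in> forms vars k"
      by (simp add: forms_def poly_ring_closed)
    have "L \<otimes>\<^bsub>?Q\<^esub> quot_class vars ?I z = quot_class vars ?I (p * z)"
      unfolding p(2) by (rule quot_class_mult[OF I p_carrier forms_in_carrier[OF z(1)]])
    also have "\<dots> = quot_class vars ?I (p * 0)"
      using z(3) p_carrier forms_in_carrier[OF z(1)]
      by (simp add: quot_class_eq_iff[OF I] poly_ring_closed)
    also have "\<dots> = L \<otimes>\<^bsub>?Q\<^esub> quot_class vars ?I 0"
      unfolding p(2) by (rule quot_class_mult[OF I p_carrier poly_ring_closed(1), symmetric])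
    finally have "L \<otimes>\<^bsub>?Q\<^esub> quot_class vars ?I z = L \<otimes>\<^bsub>?Q\<^esub> quot_class vars ?I 0" .
    then have "quot_class vars ?I z = quot_class vars ?I 0"
      using inj z(1) zero unfolding graded_piece_def by (auto dest: inj_onD)
    then show False
      using z(2) quot_class_eq_zero_iff[OF I forms_in_carrier[OF z(1)]] quot_class_0[OF I] by simp
  qed
  then have surj: "(\<lambda>a. L \<otimes>\<^bsub>?Q\<^esub> a) ` graded_piece vars ?I k = graded_piece vars ?I (Suc k)"
    using L(2) by blast
  have "2 * (k + 1) \<le> n + 3" "n + 1 - (k + 1) = n - k" unfolding k_def by auto
  then obtain z where z: "z \<in> forms vars (n - k)" "z \<notin> ?I" "p * z \<in> ?I"
    using ex_form_killed[OF S _ p(1), of "k + 1"] unfolding F_def by metis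
  note z_carrier = forms_in_carrier[OF z(1)]
  \<comment> \<open>A witness that z is nonzero modulo the annihilator; by homogeneity it has degree
    k + 1, so surjectivity writes its class as L times that of some g.\<close>
  obtain t where t: "t \<in> monoms vars" "pairing F (z * single t 1) \<noteq> 0"
    using z(2) z_carrier unfolding Ann_iff[OF F] by blast
  have "mdeg t = Suc k"
  proof -
    obtain s where "s \<in> keys z" "lookup F (s + t) \<noteq> 0"
      using t(2) unfolding pairing_mult_single_eq_sum[OF finite_keys subset_refl]
      by (metis (no_types, lifting) mult_zero_right sum.neutral)
    then have "mdeg s = n - k" "mdeg (s + t) = n + 1"
      using z(1) lookup_eq_0_if_mdeg_neq[OF F] by (auto simp: forms_def)
    then show ?thesis by (simp add: mdeg_add k_def)
  qed
  then have t_form: "single t (1 :: 'k) \<in> forms vars (Suc k)"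
    using t(1) by (simp add: forms_def single_in_carrier)
  then have "quot_class vars ?I (single t 1) \<in> graded_piece vars ?I (Suc k)"
    unfolding graded_piece_def by blast
  then have "quot_class vars ?I (single t 1) \<in> (\<lambda>a. L \<otimes>\<^bsub>?Q\<^esub> a) ` graded_piece vars ?I k"
    unfolding surj .
  then obtain g where g: "g \<in> forms vars k"
    "quot_class vars ?I (single t 1) = L \<otimes>\<^bsub>?Q\<^esub> quot_class vars ?I g"
    unfolding graded_piece_def by blast
  note g_carrier = forms_in_carrier[OF g(1)]
  have "single t 1 - p * g \<in> ?I"
    using g(2) forms_in_carrier[OF t_form] p_carrier g_carrier
    by (simp add: p(2) quot_class_mult[OF I] quot_class_eq_iff[OF I] poly_ring_closed)
  then have "pairing F ((single t 1 - p * g) * z) = 0" "pairing F (p * z * g) = 0"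
    using pairing_Ann_mult[OF F] z(3) z_carrier g_carrier by blast+
  \<comment> \<open>Both summands pair to zero, the second because p z lies in the annihilator; this
    contradicts the choice of t.\<close>
  moreover have "z * single t 1 = (single t 1 - p * g) * z + p * z * g"
    by (simp add: algebra_simps)
  ultimately have "pairing F (z * single t 1) = 0"
    by (simp only: pairing_add add_0)
  then show False using t(2) by simp
qed

lemma ex_facet: "\<exists>i. i \<in> {1..m}"
proof -
  have "{} \<in> independent_sets {1..n} E"
    using graph by (auto simp: independent_sets_def simple_graph_def)
  then show ?thesis by (elim facet_exists) blast
qed

lemma graph_form_nonzero: "(graph_form m Fs :: (graph_var, 'k::comm_ring_1) mpoly) \<noteq> 0"
proof -
  obtain i where "i \<in> {1..m}" using ex_facet by blast
  then have "lookup (graph_form m Fs :: (graph_var, 'k) mpoly) (fmon Fs i) = 1"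
    unfolding lookup_graph_form[OF finite_facet] by simp
  then show ?thesis by (metis lookup_zero zero_neq_one)
qed

end

text \<open>A maximum independent set can be thinned out, since independence passes to
  subsets.\<close>

lemma ex_independent_set_card:
  assumes "simple_graph V E" "k \<le> independence_number V E"
  obtains S where "S \<in> independent_sets V E" "card S = k"
proof -
  have "finite (independent_sets V E)"
    using assms(1) by (auto simp: simple_graph_def independent_sets_def)
  moreover have "{} \<in> independent_sets V E"
    using assms(1) by (auto simp: simple_graph_def independent_sets_def)
  ultimately have "independence_number V E \<in> card ` independent_sets V E"
    unfolding independence_number_def by (intro Max_in) auto
  then obtain T where T: "T \<in> independent_sets V E" "k \<le> card T"
    using assms(2) by auto
  obtain S where "S \<subseteq> T" "card S = k"
    using obtain_subset_with_card_n[OF T(2)] by blast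
  then show ?thesis using that independent_set_subset[OF T(1)] by blast
qed

theorem theorem4p6:
  fixes n m :: nat and E :: "nat set set" and Fs :: "nat \<Rightarrow> nat set"
  assumes "simple_graph {1..n} E"
    and "real (independence_number {1..n} E) \<ge> real n / 3 + 2"
    and "bij_betw Fs {1..m} (maximal_independent_sets {1..2 * n} (whisker n E))"
  shows "\<exists>I. macaulay_dual_generator (graph_vars m (2 * n))
               (graph_form m Fs :: (graph_var, 'k::field_char_0) mpoly) I
           \<and> artinian_gorenstein (graph_vars m (2 * n)) I
           \<and> G_quadratic (graph_vars m (2 * n)) I
           \<and> \<not> weak_lefschetz (graph_vars m (2 * n)) I"
proof -
  interpret whiskered_graph n m E Fs
    using assms(1,3) by unfold_locales
  let ?F = "graph_form m Fs :: (graph_var, 'k) mpoly"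
  have fin: "finite (graph_vars m (2 * n))" by (simp add: graph_vars_def)
  \<comment> \<open>With \<alpha> <= n the hypothesis gives \<alpha> >= \<alpha>/3 + 2, that is
    \<alpha> >= 3.\<close>
  have "independence_number {1..n} E \<le> n"
  proof -
    obtain S where S: "S \<in> independent_sets {1..n} E" "card S = independence_number {1..n} E"
      using ex_independent_set_card[OF assms(1) le_refl] .
    then have "S \<subseteq> {1..n}" by (simp add: independent_sets_def)
    then show ?thesis using card_mono[of "{1..n}" S] S(2) by simp
  qed
  then have "3 \<le> independence_number {1..n} E"
    using assms(2) by linarith
  then obtain S where S: "S \<in> independent_sets {1..n} E" "card S = 3"
    using ex_independent_set_card[OF assms(1)] by blast
  have "G_quadratic (graph_vars m (2 * n)) (Ann (graph_vars m (2 * n)) ?F)"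
    using fin ideal_Ann[OF form_in_forms] leading_monom_dvd by (rule G_quadraticI)
  moreover have "macaulay_dual_generator (graph_vars m (2 * n)) ?F (Ann (graph_vars m (2 * n)) ?F)"
    unfolding macaulay_dual_generator_def using graph_form_nonzero form_in_forms by blast
  ultimately show ?thesis
    using artinian_gorenstein_Ann[OF form_in_forms fin graph_form_nonzero] not_weak_lefschetz[OF S]
    by blast
qed

end
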